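(* Fix $\sigma,\tau\ge0$ with $\sigma\tau<1$ and $\eta,\theta\in\mathbb{R}$ such that $1+\alpha\beta>0$, where $\alpha=\frac{\eta+\theta\sigma}{1-\sigma\tau}$ and $\beta=\frac{\eta\tau+\theta}{1-\sigma\tau}$. Let $\gamma=-\sigma\tau$, and for $t>0$ let $\varphi_t$ be the continuous solution (for $z$ near $0$) of $$(z^2+\eta z+\sigma)(t+\tau)\varphi_t^2+\big((\theta-t\eta)z-2t\sigma-\sigma\tau-1\big)\varphi_t+t\sigma+1=0$$ with $\varphi_t(0)=1$. Then $\varphi_t$ is the moment generating function of a unique probability measure $\nu_t$ on $\mathbb{R}$, i.e. $\varphi_t(z)=\sum_{k\ge0}z^k\int y^k\,\nu_t(dy)$ for small $|z|$, and the generator of the quadratic harness with parameters $\eta,\theta,\sigma,\tau,\gamma$ acts on every polynomial $p$ by $$\mathsf{A}_t(p)(x)=\frac{1+\eta x+\sigma x^2}{1+\sigma t}\int\frac{\partial}{\partial x}\Big(\frac{p(y)-p(x)}{y-x}\Big)\nu_t(dy),\qquad t>0.$$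
   Context: $\mathcal{Q}$ denotes the real linear space of all infinite sequences $(p_0,p_1,\dots)$ of real polynomials in $x$; a linear map $\mathsf{P}$ of the polynomial space is identified with the sequence $(\mathsf{P}(1),\mathsf{P}(x),\mathsf{P}(x^2),\dots)$, and the product on $\mathcal{Q}$ is the one corresponding to composition: for $\mathbb{P}=(p_k)$, $\mathbb{Q}=(q_k)$, $\mathbb{P}\mathbb{Q}=(r_k)$ with $r_k(x)=\sum_j[q_k]_jp_j(x)$, $[q]_j$ the coefficient of $x^j$. Special elements: $\mathbb{E}=(1,x,x^2,\dots)$, $\mathbb{F}=(x,x^2,\dots)$, $\mathbb{D}=(0,1,x,\dots)$. A polynomial process is a family $\{\mathbb{P}_{s,t}\in\mathcal{Q}:0\le s\le t\}$ with: (i) the $n$-th component of $\mathbb{P}_{s,t}$ has degree exactly $n$; (ii) $\mathbb{P}_{s,t}(\mathbb{E}-\mathbb{F}\mathbb{D})=\mathbb{E}-\mathbb{F}\mathbb{D}$; (iii) $\mathbb{P}_{s,t}\mathbb{P}_{t,u}=\mathbb{P}_{s,u}$ for $s\le t\le u$. It is a quadratic harness with parameters $\eta,\theta,\sigma,\tau,\gamma$ if (a) $\mathbb{P}_{s,t}(\mathbb{F}\mathbb{D}-\mathbb{F}^2\mathbb{D}^2)=\mathbb{F}\mathbb{D}-\mathbb{F}^2\mathbb{D}^2$; (b) there is $\mathbb{X}\in\mathcal{Q}$ with $\mathbb{P}_{0,t}\mathbb{F}=(\mathbb{F}+t\mathbb{X})\mathbb{P}_{0,t}$ for all $t\ge0$;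 (c) $\mathbb{X}\mathbb{F}-\gamma\mathbb{F}\mathbb{X}=\mathbb{E}+\eta\mathbb{F}+\theta\mathbb{X}+\sigma\mathbb{F}^2+\tau\mathbb{X}^2$. The generator is the linear map $\mathsf{A}_t$ of the polynomial space given by $\mathsf{A}_t(p)=\lim_{h\to0^+}\frac1h(\mathsf{P}_{t-h,t}(p)-p)$ (coefficientwise limit), where $\mathsf{P}_{s,t}$ is the linear map corresponding to $\mathbb{P}_{s,t}$. *)

theory Defs
  imports "HOL-Probability.Probability" "HOL-Computational_Algebra.Polynomial"
begin

type_synonym qseq = "nat \<Rightarrow> real poly"

text \<open>Product corresponding to composition: (P Q)_k = sum_j [q_k]_j p_j.\<close>
definition qmul :: "qseq \<Rightarrow> qseq \<Rightarrow> qseq" where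
  "qmul P Q = (\<lambda>k. \<Sum>j\<le>degree (Q k). smult (coeff (Q k) j) (P j))"

definition qadd :: "qseq \<Rightarrow> qseq \<Rightarrow> qseq" where
  "qadd P Q = (\<lambda>k. P k + Q k)"

definition qsub :: "qseq \<Rightarrow> qseq \<Rightarrow> qseq" where
  "qsub P Q = (\<lambda>k. P k - Q k)"

definition qscale :: "real \<Rightarrow> qseq \<Rightarrow> qseq" where
  "qscale c P = (\<lambda>k. smult c (P k))"

definition qE :: qseq where "qE = (\<lambda>k. monom 1 k)"
definition qF :: qseq where "qF = (\<lambda>k. monom 1 (Suc k))"
definition qD :: qseq where "qD = (\<lambda>k. if k = 0 then 0 else monom 1 (k - 1))"

text \<open>The linear map of the polynomial space identified with a sequence P.\<close>
definition qapp :: "qseq \<Rightarrow> real poly \<Rightarrow> real poly" where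
  "qapp P p = (\<Sum>j\<le>degree p. smult (coeff p j) (P j))"

definition polynomial_process :: "(real \<Rightarrow> real \<Rightarrow> qseq) \<Rightarrow> bool" where
  "polynomial_process P \<longleftrightarrow>
     (\<forall>s t. 0 \<le> s \<and> s \<le> t \<longrightarrow>
        (\<forall>n. P s t n \<noteq> 0 \<and> degree (P s t n) = n) \<and>
        qmul (P s t) (qsub qE (qmul qF qD)) = qsub qE (qmul qF qD)) \<and>
     (\<forall>s t u. 0 \<le> s \<and> s \<le> t \<and> t \<le> u \<longrightarrow> qmul (P s t) (P t u) = P s u)"

definition quadratic_harness ::
  "(real \<Rightarrow> real \<Rightarrow> qseq) \<Rightarrow> real \<Rightarrow> real \<Rightarrow> real \<Rightarrow> real \<Rightarrow> real \<Rightarrow> bool" where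
  "quadratic_harness P \<eta> \<theta> \<sigma> \<tau> \<gamma> \<longleftrightarrow>
     polynomial_process P \<and>
     (\<forall>s t. 0 \<le> s \<and> s \<le> t \<longrightarrow>
        qmul (P s t) (qsub (qmul qF qD) (qmul (qmul qF qF) (qmul qD qD)))
          = qsub (qmul qF qD) (qmul (qmul qF qF) (qmul qD qD))) \<and>
     (\<exists>X. (\<forall>t\<ge>0. qmul (P 0 t) qF = qmul (qadd qF (qscale t X)) (P 0 t)) \<and>
          qsub (qmul X qF) (qscale \<gamma> (qmul qF X)) =
            qadd (qadd (qadd (qadd qE (qscale \<eta> qF)) (qscale \<theta> X))
                       (qscale \<sigma> (qmul qF qF))) (qscale \<tau> (qmul X X)))"

definition generator_is :: "(real \<Rightarrow> real \<Rightarrow> qseq) \<Rightarrow> real \<Rightarrow> real poly \<Rightarrow> real poly \<Rightarrow> bool" where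
  "generator_is P t p q \<longleftrightarrow>
     (\<forall>n. ((\<lambda>h. coeff (qapp (P (t - h) t) p - p) n / h) \<longlongrightarrow> coeff q n) (at_right 0))"

definition divdiff :: "real poly \<Rightarrow> real \<Rightarrow> real \<Rightarrow> real" where
  "divdiff p x y = (if y = x then poly (pderiv p) x else (poly p y - poly p x) / (y - x))"

definition is_mgf_of :: "(real \<Rightarrow> real) \<Rightarrow> real measure \<Rightarrow> bool" where
  "is_mgf_of \<phi> \<nu> \<longleftrightarrow>
     prob_space \<nu> \<and> sets \<nu> = sets borel \<and>
     (\<forall>k. integrable \<nu> (\<lambda>y. y ^ k)) \<and>
     (\<exists>\<epsilon>>0. \<forall>z. \<bar>z\<bar> < \<epsilon> \<longrightarrow> (\<lambda>k. z ^ k * (\<integral>y. y ^ k \<partial>\<nu>)) sums \<phi> z)"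

end

theory Submission
  imports Defs
begin

text \<open>
  Matching the quadratic equation for \<open>\<phi>\<close> with a continued fraction identifies \<open>\<nu>\<close> as the spectral
  measure of a Jacobi matrix whose coefficients are constant from the second row on:
  the diagonal is \<open>\<beta>, a, a, \<dots>\<close> and the squared off-diagonal is \<open>g, b, b, \<dots>\<close> with
  \<open>g = (t + \<tau>) (1 + \<alpha> \<beta>) / (1 - \<sigma> \<tau>) > 0\<close> and \<open>b = g (1 + t \<sigma>) / (1 - \<sigma> \<tau>)\<close>. Such a matrix is bounded, so
  its moment functional is positive on a compact interval and is represented by a measure;
  exponential growth of the moments gives uniqueness through the characteristic function.

  On the side of the harness, put \<open>H s = P 0 s ^ (-1) X P 0 s\<close>. Conjugating the q-commutation relation
  gives a quadratic equation for \<open>H s\<close> that, together with \<open>H s 1 = 0\<close>, determines \<open>H s\<close> recursively and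
  shows that it is continuous in \<open>s\<close>. Since \<open>P (t - h) t (x p) = x P (t - h) t p + h H (t - h) P (t - h) t p\<close>,
  the generator exists and its commutator with multiplication by \<open>x\<close> is \<open>H t\<close>. Finally, the generating
  function of the moments of \<open>\<nu>\<close> satisfies the given quadratic equation exactly when the operator
  \<open>p \<mapsto> (1 + \<eta> x + \<sigma> x\<^sup>2) / (1 + \<sigma> t) \<integral> (p y - p x) / (y - x) \<nu>(dy)\<close> satisfies the equation for \<open>H t\<close>.
\<close>

section \<open>The moment problem on the unit interval\<close>

text \<open>Falling factorials linearise the Bernstein sums, see \<open>Bernstein_ffact\<close>.\<close>
definition ffact :: "nat \<Rightarrow> nat \<Rightarrow> nat" where
  "ffact n k = (\<Prod>i<k. n - i)"

lemma ffact_0 [simp]: "ffact n 0 = 1"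
  and ffact_Suc: "ffact n (Suc k) = ffact n k * (n - k)"
  by (simp_all add: ffact_def)

lemma ffact_Suc_Suc: "ffact (Suc n) (Suc k) = Suc n * ffact n k"
  unfolding ffact_def by (subst prod.lessThan_Suc_shift) simp

lemma ffact_0_Suc: "ffact 0 (Suc k) = 0"
  by (simp add: ffact_def)

text \<open>Induction on \<open>k\<close>, changing one factor at a time: \<open>j / n\<close> and
  \<open>(j - k) / n\<close> differ by at most \<open>k / n\<close>, and all other factors lie in
  the unit interval, so the errors add up to at most \<open>k * k / n\<close>.\<close>

lemma ffact_approx:
  assumes "j \<le> n" "n > 0"
  shows "\<bar>(real j / real n) ^ k - real (ffact j k) / real n ^ k\<bar> \<le> real (k * k) / real n"
proof (induction k)
  case (Suc k)
  let ?x = "real j / real n" and ?f = "real (ffact j k) / real n ^ k"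
  have x: "0 \<le> ?x" "?x \<le> 1" using assms by (auto simp: field_simps)
  have "ffact j k \<le> j ^ k"
    unfolding ffact_def by (rule order.trans[OF prod_mono[of _ _ "\<lambda>_. j"]]) auto
  also have "j ^ k \<le> n ^ k" using assms by (intro power_mono) auto
  finally have "real (ffact j k) \<le> real n ^ k" by (metis of_nat_le_iff of_nat_power)
  then have f: "0 \<le> ?f" "?f \<le> 1" using assms by (auto simp: field_simps)
  have y: "\<bar>?x - real (j - k) / real n\<bar> \<le> real k / real n"
  proof -
    have "\<bar>real j - real (j - k)\<bar> \<le> real k" by linarith
    then show ?thesis
      unfolding diff_divide_distrib[symmetric] abs_divide abs_of_nat by (intro divide_right_mono) auto
  qed
  have "?x ^ Suc k - real (ffact j (Suc k)) / real n ^ Suc k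
     = ?x * (?x ^ k - ?f) + ?f * (?x - real (j - k) / real n)"
  proof -
    have "real (ffact j (Suc k)) / real n ^ Suc k = ?f * (real (j - k) / real n)"
      by (simp add: ffact_Suc)
    moreover have "x * x ^ k - f * y = x * (x ^ k - f) + f * (x - y)" for x y f :: real
      by (simp add: right_diff_distrib)
    ultimately show ?thesis by (metis power_Suc)
  qed
  also have "\<bar>\<dots>\<bar> \<le> 1 * (real (k * k) / real n) + 1 * (real k / real n)"
    unfolding abs_mult[symmetric]
    by (rule order.trans[OF abs_triangle_ineq], unfold abs_mult, intro add_mono mult_mono Suc y)
       (use x f in auto)
  also have "\<dots> \<le> real (Suc k * Suc k) / real n"
    unfolding add_divide_distrib[symmetric] mult_1 by (intro divide_right_mono) auto
  finally show ?case .
qed simp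

text \<open>Each step of the induction on \<open>k\<close> absorbs a factor \<open>j\<close> into
  the binomial coefficient, via \<open>Suc j * (Suc m choose Suc j) = Suc m * (m choose j)\<close>;
  what remains at \<open>k = 0\<close> is the binomial theorem.\<close>

lemma Bernstein_ffact:
  fixes x y :: "'a :: comm_ring_1"
  shows "(\<Sum>j\<le>n. of_nat (ffact j k * (n choose j)) * (x ^ j * y ^ (n - j)))
       = of_nat (ffact n k) * (x ^ k * (x + y) ^ (n - k))"
proof (induction k arbitrary: n)
  case 0
  then show ?case by (simp add: binomial_ring mult.assoc)
next
  case (Suc k)
  show ?case
  proof (cases n)
    case 0
    then show ?thesis by (simp add: ffact_0_Suc)
  next
    case (Suc m)
    have "(\<Sum>j\<le>n. of_nat (ffact j (Suc k) * (n choose j)) * (x ^ j * y ^ (n - j)))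
      = (\<Sum>j\<le>m. of_nat (ffact (Suc j) (Suc k) * (Suc m choose Suc j)) * (x ^ Suc j * y ^ (m - j)))"
      unfolding Suc by (subst sum.atMost_Suc_shift) (simp add: ffact_0_Suc)
    also have "\<dots> = (\<Sum>j\<le>m. of_nat (Suc m) * x * (of_nat (ffact j k * (m choose j)) * (x ^ j * y ^ (m - j))))"
    proof (rule sum.cong[OF refl])
      fix j
      have "ffact (Suc j) (Suc k) * (Suc m choose Suc j) = Suc m * (ffact j k * (m choose j))"
        unfolding ffact_Suc_Suc using Suc_times_binomial[of j m] by (metis mult.assoc mult.commute)
      then show "of_nat (ffact (Suc j) (Suc k) * (Suc m choose Suc j)) * (x ^ Suc j * y ^ (m - j))
        = of_nat (Suc m) * x * (of_nat (ffact j k * (m choose j)) * (x ^ j * y ^ (m - j)))"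
        by (simp only: of_nat_mult power_Suc) (simp add: mult_ac)
    qed
    also have "\<dots> = of_nat (Suc m) * x * (of_nat (ffact m k) * (x ^ k * (x + y) ^ (m - k)))"
      by (simp only: sum_distrib_left[symmetric] Suc.IH)
    also have "\<dots> = of_nat (ffact n (Suc k)) * (x ^ Suc k * (x + y) ^ (n - Suc k))"
      unfolding Suc ffact_Suc_Suc by (simp only: of_nat_mult power_Suc diff_Suc_Suc mult_ac)
    finally show ?thesis .
  qed
qed

text \<open>The positivity conditions are those of integration against a measure on the unit
  interval. They make \<open>L\<close> nonnegative on the Bernstein basis, which is how they
  enter.\<close>

locale unit_interval_functional =
  fixes L :: "real poly \<Rightarrow> real"
  assumes add: "L (p + q) = L p + L q"
    and scale: "L (smult c p) = c * L p"
    and one: "L 1 = 1"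
    and psd: "L (p * p) \<ge> 0"
    and psd_left: "L ([:0, 1:] * (p * p)) \<ge> 0"
    and psd_right: "L ([:1, -1:] * (p * p)) \<ge> 0"
begin

lemma sum: "L (\<Sum>x\<in>A. f x) = (\<Sum>x\<in>A. L (f x))"
proof (induction A rule: infinite_finite_induct)
  case empty
  show ?case using scale[of 0 0] by simp
next
  case (infinite A)
  then show ?case using scale[of 0 0] by simp
qed (simp add: add)

text \<open>The even parts of the exponents form a square, which leaves one of the factors 1,
  \<open>x\<close>, \<open>1 - x\<close>, \<open>x (1 - x)\<close>. The last is reduced to the
  others by \<open>x (1 - x) = (1 - x) x^2 + x (1 - x)^2\<close>.\<close>

lemma Bernstein_nonneg: "L ([:0, 1:] ^ i * [:1, -1:] ^ j) \<ge> 0"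
proof -
  let ?x = "[:0, 1:] :: real poly" and ?y = "[:1, -1:] :: real poly"
  define p where "p = ?x ^ (i div 2) * ?y ^ (j div 2)"
  have split: "q ^ m = q ^ (m div 2) * q ^ (m div 2) * (if even m then 1 else q)" for q :: "real poly" and m
    by (cases "even m") (auto elim!: evenE oddE simp: power_add mult_2 mult_2_right mult_ac)
  have sq: "?x ^ i * ?y ^ j = (if even i then 1 else ?x) * (if even j then 1 else ?y) * (p * p)"
    unfolding p_def split[of ?x i] split[of ?y j] by (simp only: mult_ac)
  have xy: "?x * ?y = ?y * (?x * ?x) + ?x * (?y * ?y)" by simp
  have "L (?x * ?y * (p * p)) = L (?y * ((?x * p) * (?x * p))) + L (?x * ((?y * p) * (?y * p)))"
    unfolding add[symmetric] by (subst xy) (simp only: distrib_right distrib_left mult_ac)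
  also have "\<dots> \<ge> 0" by (intro add_nonneg_nonneg psd_left psd_right)
  finally show ?thesis unfolding sq
    using psd[of p] psd_left[of p] psd_right[of p]
    by (cases "even i"; cases "even j") (simp_all only: if_True if_False mult_1_left mult_1_right)
qed

text \<open>The value of \<open>L\<close> on a Bernstein basis polynomial approximates the mass that
  the wanted measure has near \<open>j / n\<close>. The value 0 for \<open>j > n\<close> gives a
  mass function on all natural numbers.\<close>

definition weight :: "nat \<Rightarrow> nat \<Rightarrow> real" where
  "weight n j = (if j \<le> n then real (n choose j) * L ([:0, 1:] ^ j * [:1, -1:] ^ (n - j)) else 0)"

lemma weight_nonneg: "weight n j \<ge> 0"
  by (simp add: weight_def Bernstein_nonneg del: mult_pCons_left)

text \<open>This is \<open>L\<close> applied to \<open>Bernstein_ffact\<close> with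
  \<open>y = 1 - x\<close>, where the power of \<open>x + y\<close> becomes 1.\<close>

lemma weight_ffact: "(\<Sum>j\<le>n. real (ffact j k) * weight n j) = real (ffact n k) * L ([:0, 1:] ^ k)"
proof -
  let ?x = "[:0, 1:] :: real poly" and ?y = "[:1, -1:] :: real poly"
  have of_nat: "of_nat m * p = smult (real m) p" for m and p :: "real poly"
    by (simp add: of_nat_poly)
  have "(\<Sum>j\<le>n. real (ffact j k) * weight n j)
      = L (\<Sum>j\<le>n. of_nat (ffact j k * (n choose j)) * (?x ^ j * ?y ^ (n - j)))"
    unfolding sum of_nat scale by (intro sum.cong) (auto simp: weight_def)
  also have "\<dots> = L (of_nat (ffact n k) * (?x ^ k * (?x + ?y) ^ (n - k)))"
    by (subst Bernstein_ffact) simp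
  also have "?x + ?y = 1" by (simp add: one_pCons)
  finally show ?thesis by (simp only: of_nat scale power_one mult_1_right)
qed

lemma weight_sum: "(\<Sum>j\<le>n. weight n j) = 1"
  using weight_ffact[where k = 0 and n = n] by (simp add: one)

text \<open>The intermediate quantity is the exact falling factorial moment, divided by
  \<open>n ^ k\<close>. By \<open>ffact_approx\<close> it is close to the left-hand sum, and its
  factor \<open>ffact n k / n ^ k\<close> is close to 1.\<close>

lemma weight_moment:
  assumes "n > 0"
  shows "\<bar>(\<Sum>j\<le>n. (real j / real n) ^ k * weight n j) - L ([:0, 1:] ^ k)\<bar>
    \<le> real (k * k) / real n * (1 + \<bar>L ([:0, 1:] ^ k)\<bar>)"
proof -
  let ?m = "L ([:0, 1:] ^ k)"
  have "\<bar>(\<Sum>j\<le>n. (real j / real n) ^ k * weight n j) - real (ffact n k) / real n ^ k * ?m\<bar>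
      = \<bar>\<Sum>j\<le>n. ((real j / real n) ^ k - real (ffact j k) / real n ^ k) * weight n j\<bar>"
    using weight_ffact[where k = k and n = n]
    by (simp add: left_diff_distrib sum_subtractf flip: sum_divide_distrib)
  also have "\<dots> \<le> (\<Sum>j\<le>n. real (k * k) / real n * weight n j)"
    by (rule order.trans[OF sum_abs], unfold abs_mult, intro sum_mono mult_mono)
       (use ffact_approx[OF _ assms] weight_nonneg in auto)
  also have "\<dots> = real (k * k) / real n"
    unfolding sum_distrib_left[symmetric] weight_sum by simp
  finally have 1: "\<bar>(\<Sum>j\<le>n. (real j / real n) ^ k * weight n j) - real (ffact n k) / real n ^ k * ?m\<bar>
      \<le> real (k * k) / real n" .
  have "\<bar>real (ffact n k) / real n ^ k * ?m - ?m\<bar> = \<bar>1 - real (ffact n k) / real n ^ k\<bar> * \<bar>?m\<bar>"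
    unfolding abs_mult[symmetric] by (simp add: algebra_simps abs_minus_commute)
  also have "\<dots> \<le> real (k * k) / real n * \<bar>?m\<bar>"
    using ffact_approx[of n n k] assms by (intro mult_right_mono) auto
  finally have 2: "\<bar>real (ffact n k) / real n ^ k * ?m - ?m\<bar> \<le> real (k * k) / real n * \<bar>?m\<bar>" .
  have "\<bar>a - c\<bar> \<le> A + B" if "\<bar>a - b\<bar> \<le> A" "\<bar>b - c\<bar> \<le> B" for a b c A B :: real
    using that by linarith
  from this[OF 1 2] show ?thesis by (simp only: distrib_left mult_1_right)
qed

text \<open>The half-open interval has the shape demanded by \<open>tight\<close> and is the same
  for all \<open>n\<close>; it starts at -1 so as to contain an atom at 0.\<close>

lemma ex_discrete:
  "\<exists>\<mu>. real_distribution \<mu> \<and> measure \<mu> {-1<..1} = 1 \<and>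
     (\<forall>f \<in> borel_measurable borel. (\<integral>x. f x \<partial>\<mu>) = (\<Sum>j\<le>n. f (real j / real n) * weight n j))"
proof -
  have "(\<integral>\<^sup>+ j. ennreal (weight n j) \<partial>count_space UNIV) = (\<integral>\<^sup>+ j. ennreal (weight n j) \<partial>count_space {..n})"
    by (subst nn_integral_count_space_indicator)
       (auto intro!: nn_integral_cong simp: indicator_def weight_def)
  also have "\<dots> = (\<Sum>j\<le>n. ennreal (weight n j))" by (simp add: nn_integral_count_space_finite)
  also have "\<dots> = 1" by (simp add: weight_nonneg weight_sum)
  finally have pmf: "pmf (embed_pmf (weight n)) j = weight n j" for j
    by (intro pmf_embed_pmf weight_nonneg)
  define W where "W = embed_pmf (weight n)"
  have W: "set_pmf W \<subseteq> {..n}"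
    unfolding W_def set_pmf_eq pmf by (auto simp: weight_def split: if_splits)
  define \<mu> where "\<mu> = distr (measure_pmf W) borel (\<lambda>j. real j / real n)"
  have dist: "real_distribution \<mu>" unfolding \<mu>_def 
    by (intro prob_space.real_distribution_distr measure_pmf.prob_space_axioms) auto
  have "measure \<mu> {-1<..1} = measure (measure_pmf W) ((\<lambda>j. real j / real n) -` {-1<..1})"
    unfolding \<mu>_def by (subst measure_distr) auto
  also have "\<dots> = 1"
  proof (subst measure_pmf.prob_eq_1, simp, subst AE_measure_pmf_iff, safe)
    fix j assume "j \<in> set_pmf W"
    then have "j \<le> n" using W by auto
    \<comment> \<open>Division by zero yields 0, so for \<open>n = 0\<close> the only atom sits at
      0.\<close>
    then show "j \<in> (\<lambda>j. real j / real n) -` {- 1<..1}"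
      by (cases "n = 0") (auto simp: field_simps)
  qed
  finally have "measure \<mu> {-1<..1} = 1" .
  moreover have "(\<integral>x. f x \<partial>\<mu>) = (\<Sum>j\<le>n. f (real j / real n) * weight n j)"
    if "f \<in> borel_measurable borel" for f
    unfolding \<mu>_def using that W
    by (subst integral_distr) (auto simp: integral_measure_pmf_real[of "{..n}"] W_def pmf subset_eq)
  ultimately show ?thesis using dist by blast
qed

text \<open>Hausdorff's moment problem, solved by a limit point of the discrete measures with the Bernstein
  weights; composing with the truncation to the unit interval avoids a discussion of the
  support of the limit.\<close>
lemma ex_measure:
  "\<exists>\<mu>. prob_space \<mu> \<and> sets \<mu> = sets borel \<and> (AE x in \<mu>. 0 \<le> x \<and> x \<le> 1) \<and>
     (\<forall>k. (\<integral>x. x ^ k \<partial>\<mu>) = L ([:0, 1:] ^ k))"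
proof -
  obtain \<mu> where \<mu>: "\<And>n. real_distribution (\<mu> n)" "\<And>n. measure (\<mu> n) {-1<..1} = 1"
    and int: "\<And>n f. f \<in> borel_measurable borel \<Longrightarrow>
      (\<integral>x. f x \<partial>\<mu> n) = (\<Sum>j\<le>n. f (real j / real n) * weight n j)"
    using ex_discrete by metis
  have "\<exists>a b::real. a < b \<and> (\<forall>n. measure (\<mu> n) {a<..b} > 1 - \<epsilon>)" if "\<epsilon> > 0" for \<epsilon> :: real
    using that by (intro exI[of _ "-1"] exI[of _ 1]) (simp add: \<mu>)
  then have "tight \<mu>" unfolding tight_def using \<mu>(1) by blast
  then obtain r M where r: "strict_mono (r :: nat \<Rightarrow> nat)" and M: "real_distribution M"
    and conv: "weak_conv_m (\<mu> \<circ> id \<circ> r) M"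
    using tight_imp_convergent_subsubsequence[of \<mu> id] by (auto simp: strict_mono_def)
  interpret M: real_distribution M by (rule M)
  interpret \<mu>: real_distribution "\<mu> n" for n by (rule \<mu>)
  define clamp :: "real \<Rightarrow> real" where "clamp = (\<lambda>x. max 0 (min 1 x))"
  have clamp: "0 \<le> clamp x" "clamp x \<le> 1" for x by (auto simp: clamp_def)
  have cont: "continuous_on UNIV clamp" unfolding clamp_def by (intro continuous_intros)
  have meas: "clamp \<in> borel_measurable borel" using cont by (rule borel_measurable_continuous_onI)
  define \<nu> where "\<nu> = distr M borel clamp"
  have "(\<integral>x. x ^ k \<partial>\<nu>) = L ([:0, 1:] ^ k)" for k
  proof -
    let ?m = "L ([:0, 1:] ^ k)"
    have "isCont (\<lambda>x. clamp x ^ k) x" for x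
      using cont by (intro continuous_intros) (auto simp: continuous_on_eq_continuous_at)
    moreover have "norm (clamp x ^ k) \<le> 1" for x
      using clamp by (simp add: power_le_one)
    ultimately have "(\<lambda>n. \<integral>x. clamp x ^ k \<partial>(\<mu> \<circ> id \<circ> r) n) \<longlonglongrightarrow> (\<integral>x. clamp x ^ k \<partial>M)"
      by (intro weak_conv_imp_integral_bdd_continuous_conv[OF _ M conv]) (auto simp: \<mu>)
    moreover have "(\<lambda>n. \<integral>x. clamp x ^ k \<partial>\<mu> n) \<longlonglongrightarrow> ?m"
    proof (rule Lim_null_comparison[THEN LIM_zero_cancel])
      have bnd: "norm ((\<integral>x. clamp x ^ k \<partial>\<mu> n) - ?m) \<le> real (k * k) / real n * (1 + \<bar>?m\<bar>)" if "n > 0" for n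
      proof -
        \<comment> \<open>The atoms \<open>j / n\<close> lie in the unit interval, where
          \<open>clamp\<close> is the identity.\<close>
        have "(\<integral>x. clamp x ^ k \<partial>\<mu> n) = (\<Sum>j\<le>n. (real j / real n) ^ k * weight n j)"
          using meas that by (subst int) (auto simp: clamp_def field_simps intro!: sum.cong)
        then show ?thesis using weight_moment[OF that] by simp
      qed
      show "eventually (\<lambda>n. norm ((\<integral>x. clamp x ^ k \<partial>\<mu> n) - ?m) \<le> real (k * k) / real n * (1 + \<bar>?m\<bar>)) sequentially"
        by (rule eventually_mono[OF eventually_gt_at_top[of 0]]) (rule bnd)
      show "(\<lambda>n. real (k * k) / real n * (1 + \<bar>?m\<bar>)) \<longlonglongrightarrow> 0"
        by (intro tendsto_mult_left_zero lim_const_over_n)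
    qed
    then have "(\<lambda>n. \<integral>x. clamp x ^ k \<partial>(\<mu> \<circ> id \<circ> r) n) \<longlonglongrightarrow> ?m"
      using LIMSEQ_subseq_LIMSEQ[OF _ r, of "\<lambda>n. \<integral>x. clamp x ^ k \<partial>\<mu> n"] by (simp add: comp_def)
    ultimately have "(\<integral>x. clamp x ^ k \<partial>M) = ?m" by (rule LIMSEQ_unique)
    then show ?thesis unfolding \<nu>_def using meas by (subst integral_distr) auto
  qed
  moreover have "prob_space \<nu>" unfolding \<nu>_def using meas by (intro M.prob_space_distr) auto
  moreover have "AE x in \<nu>. 0 \<le> x \<and> x \<le> 1"
    unfolding \<nu>_def using meas by (subst AE_distr_iff) (auto simp: clamp)
  ultimately show ?thesis by (intro exI[of _ \<nu>]) (auto simp: \<nu>_def)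
qed

end

section \<open>Bounded Jacobi matrices\<close>

text \<open>A symmetric tridiagonal matrix with diagonal \<open>a\<close> and off-diagonal
  \<open>c\<close>. Its rows are finite, so it acts on arbitrary sequences, in particular on the
  merely bounded ones of \<open>resolvent_sums\<close>.\<close>

definition jacobi :: "(nat \<Rightarrow> real) \<Rightarrow> (nat \<Rightarrow> real) \<Rightarrow> (nat \<Rightarrow> real) \<Rightarrow> nat \<Rightarrow> real" where
  "jacobi a c v i = a i * v i + c i * v (Suc i) + (case i of 0 \<Rightarrow> 0 | Suc j \<Rightarrow> c j * v j)"

lemma jacobi_0 [simp]: "jacobi a c v 0 = a 0 * v 0 + c 0 * v 1"
  and jacobi_Suc [simp]: "jacobi a c v (Suc i) =
    a (Suc i) * v (Suc i) + c (Suc i) * v (Suc (Suc i)) + c i * v i"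
  by (simp_all add: jacobi_def)

definition e0 :: "nat \<Rightarrow> real" where
  "e0 i = (if i = 0 then 1 else 0)"

locale bounded_jacobi =
  fixes a c :: "nat \<Rightarrow> real" and B :: real
  assumes a_le: "\<bar>a i\<bar> \<le> B" and c_le: "\<bar>c i\<bar> \<le> B"
begin

abbreviation "J \<equiv> jacobi a c"

text \<open>Summation by parts, expressing the symmetry of \<open>J\<close>: truncation cuts only
  the entry linking \<open>n\<close> and \<open>Suc n\<close>, which leaves the boundary
  term.\<close>

lemma jacobi_green:
  "(\<Sum>i\<le>n. J v i * w i) = (\<Sum>i\<le>n. v i * J w i) + c n * (v (Suc n) * w n - v n * w (Suc n))"
  by (induction n) (auto simp: algebra_simps)

lemma B_nonneg: "B \<ge> 0"
  using a_le[of 0] by simp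

lemma sum_shift_le:
  fixes f :: "nat \<Rightarrow> real"
  assumes "\<And>i. f i \<ge> 0" and "f (Suc n) = 0"
  shows "(\<Sum>i\<le>n. f (Suc i)) \<le> (\<Sum>i\<le>n. f i)"
  using sum.atMost_Suc_shift[of f n] sum.atMost_Suc[of f n] assms(1)[of 0] assms(2) by simp

lemma sum_back_le:
  fixes f :: "nat \<Rightarrow> real"
  assumes "\<And>i. f i \<ge> 0"
  shows "(\<Sum>i\<le>n. case i of 0 \<Rightarrow> 0 | Suc j \<Rightarrow> f j) \<le> (\<Sum>i\<le>n. f i)"
proof (cases n)
  case (Suc m)
  have "(\<Sum>i\<le>n. case i of 0 \<Rightarrow> 0 | Suc j \<Rightarrow> f j) = (\<Sum>i\<le>m. f i)"
    unfolding Suc by (subst sum.atMost_Suc_shift) simp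
  also have "\<dots> \<le> (\<Sum>i\<le>n. f i)" using assms[of "Suc m"] by (simp add: Suc)
  finally show ?thesis .
qed (use assms in auto)

text \<open>Each of the three diagonals contributes at most \<open>B\<close> times the squared norm,
  the off-diagonal ones by \<open>2 x y \<le> x^2 + y^2\<close>.\<close>

lemma jacobi_form_bound:
  assumes "v (Suc n) = 0"
  shows "\<bar>\<Sum>i\<le>n. v i * J v i\<bar> \<le> 3 * B * (\<Sum>i\<le>n. (v i)\<^sup>2)"
proof -
  have xy: "\<bar>x * (c i * y)\<bar> \<le> B / 2 * (x\<^sup>2 + y\<^sup>2)" for x y i
  proof -
    have "\<bar>x * (c i * y)\<bar> = \<bar>c i\<bar> * (\<bar>x\<bar> * \<bar>y\<bar>)" by (simp add: abs_mult)
    also have "\<dots> \<le> B * ((x\<^sup>2 + y\<^sup>2) / 2)"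
      using sum_squares_bound[of "\<bar>x\<bar>" "\<bar>y\<bar>"] c_le[of i]
      by (intro mult_mono) auto
    finally show ?thesis by simp
  qed
  let ?b = "\<lambda>i. case i of 0 \<Rightarrow> 0 | Suc j \<Rightarrow> (v j)\<^sup>2"
  have "\<bar>v i * J v i\<bar> \<le> B * (v i)\<^sup>2 + B / 2 * ((v i)\<^sup>2 + (v (Suc i))\<^sup>2) + B / 2 * ((v i)\<^sup>2 + ?b i)" for i
  proof -
    have 1: "\<bar>v i * (a i * v i)\<bar> \<le> B * (v i)\<^sup>2"
      using mult_right_mono[OF a_le[of i], of "(v i)\<^sup>2"]
      by (simp add: abs_mult power2_eq_square mult.left_commute)
    have 2: "\<bar>v i * (case i of 0 \<Rightarrow> 0 | Suc j \<Rightarrow> c j * v j)\<bar> \<le> B / 2 * ((v i)\<^sup>2 + ?b i)"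
      using xy[of "v i"] B_nonneg by (cases i) auto
    have "v i * J v i = v i * (a i * v i) + v i * (c i * v (Suc i))
        + v i * (case i of 0 \<Rightarrow> 0 | Suc j \<Rightarrow> c j * v j)"
      by (simp add: jacobi_def distrib_left)
    then show ?thesis using 1 2 xy[of "v i" i "v (Suc i)"] by linarith
  qed
  then have "\<bar>\<Sum>i\<le>n. v i * J v i\<bar> \<le>
      (\<Sum>i\<le>n. B * (v i)\<^sup>2 + B / 2 * ((v i)\<^sup>2 + (v (Suc i))\<^sup>2) + B / 2 * ((v i)\<^sup>2 + ?b i))"
    by (intro order.trans[OF sum_abs] sum_mono)
  also have "\<dots> = B * (\<Sum>i\<le>n. (v i)\<^sup>2) + B / 2 * ((\<Sum>i\<le>n. (v i)\<^sup>2) + (\<Sum>i\<le>n. (v (Suc i))\<^sup>2))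
      + B / 2 * ((\<Sum>i\<le>n. (v i)\<^sup>2) + (\<Sum>i\<le>n. ?b i))"
    by (simp only: sum.distrib flip: sum_distrib_left)
  also have "\<dots> \<le> B * (\<Sum>i\<le>n. (v i)\<^sup>2) + B / 2 * ((\<Sum>i\<le>n. (v i)\<^sup>2) + (\<Sum>i\<le>n. (v i)\<^sup>2))
      + B / 2 * ((\<Sum>i\<le>n. (v i)\<^sup>2) + (\<Sum>i\<le>n. (v i)\<^sup>2))"
    using B_nonneg assms
    by (intro add_mono mult_left_mono order.refl sum_shift_le[of "\<lambda>i. (v i)\<^sup>2"]
          sum_back_le[of "\<lambda>i. (v i)\<^sup>2"]) auto
  also have "\<dots> = 3 * B * (\<Sum>i\<le>n. (v i)\<^sup>2)" by (simp add: algebra_simps)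
  finally show ?thesis .
qed

text \<open>The l1 norm is needed besides the Euclidean one because \<open>resolvent_sums\<close>
  pairs the orbit of \<open>e0\<close> with a vector that is only bounded.\<close>

lemma jacobi_l1_bound:
  assumes "v (Suc n) = 0"
  shows "(\<Sum>i\<le>n. \<bar>J v i\<bar>) \<le> 3 * B * (\<Sum>i\<le>n. \<bar>v i\<bar>)"
proof -
  let ?b = "\<lambda>i. case i of 0 \<Rightarrow> 0 | Suc j \<Rightarrow> \<bar>v j\<bar>"
  have "\<bar>J v i\<bar> \<le> B * \<bar>v i\<bar> + B * \<bar>v (Suc i)\<bar> + B * ?b i" for i
  proof -
    have *: "\<bar>a i * x\<bar> \<le> B * \<bar>x\<bar>" "\<bar>c i * x\<bar> \<le> B * \<bar>x\<bar>" for x i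
      unfolding abs_mult using a_le[of i] c_le[of i] by (auto intro: mult_right_mono)
    have "\<bar>case i of 0 \<Rightarrow> 0 | Suc j \<Rightarrow> c j * v j\<bar> \<le> B * ?b i"
      using * by (cases i) auto
    then show ?thesis using *(1)[of i "v i"] *(2)[of i "v (Suc i)"] unfolding jacobi_def by linarith
  qed
  then have "(\<Sum>i\<le>n. \<bar>J v i\<bar>) \<le> (\<Sum>i\<le>n. B * \<bar>v i\<bar> + B * \<bar>v (Suc i)\<bar> + B * ?b i)"
    by (intro sum_mono)
  also have "\<dots> = B * (\<Sum>i\<le>n. \<bar>v i\<bar>) + B * (\<Sum>i\<le>n. \<bar>v (Suc i)\<bar>) + B * (\<Sum>i\<le>n. ?b i)"
    by (simp only: sum.distrib flip: sum_distrib_left)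
  also have "\<dots> \<le> B * (\<Sum>i\<le>n. \<bar>v i\<bar>) + B * (\<Sum>i\<le>n. \<bar>v i\<bar>) + B * (\<Sum>i\<le>n. \<bar>v i\<bar>)"
    using B_nonneg assms
    by (intro add_mono mult_left_mono order.refl sum_shift_le[of "\<lambda>i. \<bar>v i\<bar>"]
          sum_back_le[of "\<lambda>i. \<bar>v i\<bar>"]) auto
  also have "\<dots> = 3 * B * (\<Sum>i\<le>n. \<bar>v i\<bar>)" by (simp add: algebra_simps)
  finally show ?thesis .
qed

section \<open>The orbit of \<open>e0\<close> and the moment functional of \<open>J\<close>\<close>

definition orbit :: "nat \<Rightarrow> nat \<Rightarrow> real" where
  "orbit k = (J ^^ k) e0"

lemma orbit_0: "orbit 0 = e0"
  and orbit_Suc: "orbit (Suc k) = J (orbit k)"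
  by (simp_all add: orbit_def)

text \<open>A tridiagonal matrix extends the support of a vector by at most one index.\<close>

lemma orbit_eq_0: "k < i \<Longrightarrow> orbit k i = 0"
proof (induction k arbitrary: i)
  case 0
  then show ?case by (simp add: orbit_0 e0_def)
next
  case (Suc k)
  then show ?case by (cases i) (auto simp: orbit_Suc)
qed

text \<open>The vector \<open>p(J) e0\<close>.\<close>
definition pvec :: "real poly \<Rightarrow> nat \<Rightarrow> real" where
  "pvec p i = (\<Sum>k\<le>degree p. coeff p k * orbit k i)"

lemma pvec_altdef: "degree p \<le> N \<Longrightarrow> pvec p i = (\<Sum>k\<le>N. coeff p k * orbit k i)"
  unfolding pvec_def by (rule sum.mono_neutral_left) (auto simp: coeff_eq_0)

lemma pvec_add: "pvec (p + q) i = pvec p i + pvec q i"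
proof -
  define N where "N = max (degree p) (degree q)"
  have "degree p \<le> N" "degree q \<le> N" "degree (p + q) \<le> N"
    by (auto simp: N_def degree_add_le)
  then show ?thesis by (simp add: pvec_altdef[of _ N] distrib_right sum.distrib)
qed

lemma pvec_smult: "pvec (smult x p) i = x * pvec p i"
  by (subst pvec_altdef[of _ "degree p"]) (auto simp: pvec_def sum_distrib_left mult.assoc)

lemma pvec_1: "pvec 1 = e0"
  by (auto simp: pvec_def orbit_0)

lemma pvec_monom: "pvec ([:0, 1:] ^ k) i = orbit k i"
proof -
  have "[:0, 1:] ^ k = monom (1::real) k" by (simp add: monom_altdef)
  then show ?thesis
    by (simp add: pvec_altdef[of _ k] degree_monom_le if_distrib[of "\<lambda>c. c * _"] cong: if_cong)
qed

lemma jacobi_sum: "J (\<lambda>i. \<Sum>k\<in>A. f k * g k i) i = (\<Sum>k\<in>A. f k * J (g k) i)"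
  by (cases i) (simp_all add: sum_distrib_left sum.distrib distrib_left mult_ac)

lemma pvec_shift: "pvec ([:0, 1:] * p) = J (pvec p)"
proof
  fix i
  have "degree ([:0, 1:] * p) \<le> Suc (degree p)" by (simp add: degree_pCons_le)
  then have "pvec ([:0, 1:] * p) i = (\<Sum>k\<le>Suc (degree p). coeff ([:0, 1:] * p) k * orbit k i)"
    by (rule pvec_altdef)
  also have "\<dots> = (\<Sum>k\<le>degree p. coeff p k * orbit (Suc k) i)"
    by (subst sum.atMost_Suc_shift) simp
  also have "\<dots> = J (pvec p) i"
    unfolding pvec_def[abs_def] jacobi_sum orbit_Suc ..
  finally show "pvec ([:0, 1:] * p) i = J (pvec p) i" .
qed

lemma pvec_eq_0: "degree p < i \<Longrightarrow> pvec p i = 0"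
  by (auto simp: pvec_def orbit_eq_0 intro!: sum.neutral)

definition L :: "real poly \<Rightarrow> real" where
  "L p = pvec p 0"

text \<open>By symmetry of \<open>J\<close>, the factors of \<open>p(J)\<close> can be moved one by
  one to the other side of the inner product. The degree bounds make the boundary term in
  \<open>jacobi_green\<close> vanish.\<close>

lemma L_mult:
  assumes "degree p < n" "degree q < n" "degree p + degree q < n"
  shows "L (p * q) = (\<Sum>i\<le>n. pvec p i * pvec q i)"
  using assms
proof (induction p arbitrary: q)
  case 0
  then show ?case by (simp add: L_def pvec_def)
next
  case (pCons x p)
  have e0: "(\<Sum>i\<le>n. e0 i * pvec q i) = pvec q 0"
    by (simp add: e0_def if_distrib[of "\<lambda>c. c * _"] cong: if_cong)
  have pC: "pCons x p = smult x 1 + [:0, 1:] * p" by simp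
  show ?case
  proof (cases "p = 0")
    case True
    then show ?thesis unfolding pC pvec_add pvec_smult pvec_1
      by (simp add: L_def pvec_smult mult.assoc pvec_def[of 0] e0 flip: sum_distrib_left)
  next
    case False
    then have deg: "Suc (degree p) < n" "degree q < n" "Suc (degree p + degree q) < n"
      using pCons by auto
    have dq: "degree ([:0, 1:] * q) \<le> Suc (degree q)" by (simp add: degree_pCons_le)
    have "L (pCons x p * q) = x * L q + L (p * ([:0, 1:] * q))"
      unfolding pC distrib_right L_def pvec_add by (simp add: pvec_smult mult.left_commute)
    also have "L (p * ([:0, 1:] * q)) = (\<Sum>i\<le>n. pvec p i * pvec ([:0, 1:] * q) i)"
      using deg dq by (intro pCons.IH) auto
    also have "\<dots> = (\<Sum>i\<le>n. pvec ([:0, 1:] * p) i * pvec q i)"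
      using jacobi_green[of "pvec p" "pvec q" n] deg pvec_eq_0 unfolding pvec_shift by simp
    finally show ?thesis
      unfolding pC pvec_add pvec_smult pvec_1
      by (simp add: L_def distrib_right sum.distrib mult.assoc e0 flip: sum_distrib_left)
  qed
qed

lemma L_psd: "L (p * p) \<ge> 0"
  by (subst L_mult[of p "Suc (2 * degree p)" p]) (auto intro: sum_nonneg simp del: sum.atMost_Suc)

lemma L_shift_bound: "\<bar>L ([:0, 1:] * (p * p))\<bar> \<le> 3 * B * L (p * p)"
proof -
  define n where "n = Suc (Suc (2 * degree p))"
  have dp: "degree ([:0, 1:] * p) \<le> Suc (degree p)" by (simp add: degree_pCons_le)
  have "L (p * p) = (\<Sum>i\<le>n. (pvec p i)\<^sup>2)"
    unfolding power2_eq_square by (intro L_mult) (auto simp: n_def)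
  moreover have "L ([:0, 1:] * (p * p)) = L (p * ([:0, 1:] * p))"
    by (simp only: mult.left_commute)
  moreover have "L (p * ([:0, 1:] * p)) = (\<Sum>i\<le>n. pvec p i * J (pvec p) i)"
    unfolding pvec_shift[symmetric] using dp by (intro L_mult) (auto simp: n_def)
  moreover have "pvec p (Suc n) = 0" by (intro pvec_eq_0) (auto simp: n_def)
  ultimately show ?thesis using jacobi_form_bound[of "pvec p" n] by simp
qed

text \<open>The form bound confines the spectrum of \<open>J\<close> to a compact interval. After an
  affine change of variable the moment functional meets the conditions of
  \<open>unit_interval_functional\<close>, and the resulting measure is transported back.\<close>

theorem favard:
  "\<exists>\<nu>. prob_space \<nu> \<and> sets \<nu> = sets borel \<and>
     (\<forall>k. integrable \<nu> (\<lambda>x. x ^ k) \<and> (\<integral>x. x ^ k \<partial>\<nu>) = orbit k 0)"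
proof -
  \<comment> \<open>The summand 1 keeps \<open>R\<close> positive when \<open>B = 0\<close>; the map
    \<open>g\<close> below sends \<open>[-R, R]\<close> onto the unit interval.\<close>
  define R where "R = 3 * B + 1"
  have R: "R > 0" using B_nonneg by (simp add: R_def)
  define g where "g = [:1 / 2, 1 / (2 * R):]"
  define L' where "L' p = L (pcompose p g)" for p
  \<comment> \<open>The conditions say that \<open>[:x, y:]\<close> is nonnegative on
    \<open>[-R, R]\<close>. They cover both \<open>g\<close> and \<open>1 - g\<close>, with
    \<open>x = 1 / 2\<close> and \<open>\<bar>y\<bar> = 1 / (2 * R)\<close>.\<close>
  have pos: "L (smult x (p * p) + smult y ([:0, 1:] * (p * p))) \<ge> 0"
    if "x \<ge> 0" "\<bar>y\<bar> * R \<le> x" for x y p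
  proof -
    have "\<bar>y * L ([:0, 1:] * (p * p))\<bar> \<le> \<bar>y\<bar> * (R * L (p * p))"
      unfolding abs_mult using L_shift_bound[of p] L_psd[of p]
      by (intro mult_left_mono) (auto simp: R_def distrib_right simp del: mult_pCons_left)
    also have "\<dots> \<le> x * L (p * p)"
      unfolding mult.assoc[symmetric] by (intro mult_right_mono L_psd that)
    finally show ?thesis unfolding L_def pvec_add pvec_smult by (simp add: abs_le_iff)
  qed
  interpret unit_interval_functional L'
  proof
    fix p q :: "real poly" and x :: real
    show "L' (p + q) = L' p + L' q"
      by (simp add: L'_def pcompose_add L_def pvec_add)
    show "L' (smult x p) = x * L' p"
      by (simp add: L'_def pcompose_smult L_def pvec_smult)
    show "L' 1 = 1" by (simp add: L'_def L_def pcompose_1 pvec_1 e0_def)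
    show "L' (p * p) \<ge> 0" by (simp add: L'_def pcompose_mult L_psd)
    let ?q = "pcompose p g"
    have 1: "pcompose ([:0, 1:] * (p * p)) g
        = smult (1 / 2) (?q * ?q) + smult (1 / (2 * R)) ([:0, 1:] * (?q * ?q))"
      by (subst poly_eq_poly_eq_iff[symmetric]) (auto simp: fun_eq_iff poly_pcompose g_def algebra_simps)
    have 2: "pcompose ([:1, -1:] * (p * p)) g
        = smult (1 / 2) (?q * ?q) + smult (- 1 / (2 * R)) ([:0, 1:] * (?q * ?q))"
      by (subst poly_eq_poly_eq_iff[symmetric]) (auto simp: fun_eq_iff poly_pcompose g_def algebra_simps)
    show "L' ([:0, 1:] * (p * p)) \<ge> 0"
      unfolding L'_def 1 using R by (intro pos) auto
    show "L' ([:1, -1:] * (p * p)) \<ge> 0"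
      unfolding L'_def 2 using R by (intro pos) auto
  qed
  obtain \<mu> where \<mu>: "prob_space \<mu>" "sets \<mu> = sets borel" "AE x in \<mu>. 0 \<le> x \<and> x \<le> 1"
    "\<And>k. (\<integral>x. x ^ k \<partial>\<mu>) = L' ([:0, 1:] ^ k)"
    using ex_measure by blast
  interpret prob_space \<mu> by (rule \<mu>)
  note [measurable_cong] = \<mu>(2)
  have int: "integrable \<mu> (\<lambda>x. x ^ k)" for k
    by (rule integrable_const_bound[where B = 1]) (use \<mu>(3) in \<open>auto simp: power_le_one power_abs\<close>)
  have poly: "integrable \<mu> (poly p) \<and> (\<integral>x. poly p x \<partial>\<mu>) = L' p" for p
  proof -
    have "L' p = (\<Sum>k\<le>degree p. coeff p k * L' ([:0, 1:] ^ k))"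
    proof -
      have "p = (\<Sum>k\<le>degree p. smult (coeff p k) ([:0, 1:] ^ k))"
        using poly_as_sum_of_monoms[of p] by (simp add: monom_altdef)
      then show ?thesis using sum[of "\<lambda>k. smult (coeff p k) ([:0, 1:] ^ k)" "{..degree p}"]
        by (simp only: scale)
    qed
    then show ?thesis using int by (simp add: poly_altdef[abs_def] \<mu>(4))
  qed
  \<comment> \<open>The polynomial \<open>[:- R, 2 * R:]\<close> is the inverse of
    \<open>g\<close>.\<close>
  define \<nu> where "\<nu> = distr \<mu> borel (poly [:- R, 2 * R:])"
  have meas: "poly p \<in> borel_measurable \<mu>" for p by (simp add: poly_altdef[abs_def])
  have "integrable \<nu> (\<lambda>x. x ^ k) \<and> (\<integral>x. x ^ k \<partial>\<nu>) = orbit k 0" for k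
  proof -
    have pc: "pcompose [:- R, 2 * R:] g = [:0, 1:]"
      using R by (simp add: g_def pcompose_pCons)
    have "integrable \<nu> (\<lambda>x. x ^ k) \<longleftrightarrow> integrable \<mu> (poly ([:- R, 2 * R:] ^ k))"
      unfolding \<nu>_def by (subst integrable_distr_eq) (auto simp: meas poly_power[abs_def])
    moreover have "(\<integral>x. x ^ k \<partial>\<nu>) = (\<integral>x. poly ([:- R, 2 * R:] ^ k) x \<partial>\<mu>)"
      unfolding \<nu>_def by (subst integral_distr) (auto simp: meas poly_power[abs_def])
    moreover have "L' ([:- R, 2 * R:] ^ k) = orbit k 0"
    proof -
      have "pcompose (q ^ k) g = pcompose q g ^ k" for q
        by (induction k) (simp_all add: pcompose_1 pcompose_mult)
      then show ?thesis unfolding L'_def L_def pc by (simp only: pc pvec_monom)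
    qed
    ultimately show ?thesis using poly[of "[:- R, 2 * R:] ^ k"] by (simp only: simp_thms)
  qed
  moreover have "prob_space \<nu>" unfolding \<nu>_def by (intro prob_space_distr) (rule meas)
  ultimately show ?thesis by (intro exI[of _ \<nu>]) (auto simp: \<nu>_def)
qed

lemma orbit_l1: "(\<Sum>i\<le>n. \<bar>orbit k i\<bar>) \<le> (3 * B) ^ k" if "k \<le> n"
  using that
proof (induction k)
  case 0
  then show ?case by (simp add: orbit_0 e0_def if_distrib[of abs] cong: if_cong)
next
  case (Suc k)
  have "(\<Sum>i\<le>n. \<bar>orbit (Suc k) i\<bar>) \<le> 3 * B * (\<Sum>i\<le>n. \<bar>orbit k i\<bar>)"
    unfolding orbit_Suc using Suc by (intro jacobi_l1_bound orbit_eq_0) auto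
  also have "\<dots> \<le> 3 * B * (3 * B) ^ k"
    using Suc B_nonneg by (intro mult_left_mono) auto
  finally show ?case by simp
qed

text \<open>The vector \<open>u\<close> solves \<open>(1 - z J) u = e0\<close>, and the claim is the
  Neumann series of its first entry. Pairing the equation with \<open>J ^ k e0\<close> gives a
  recursion whose remainder is \<open>z ^ n\<close> times the pairing of \<open>J ^ n e0\<close>
  with \<open>u\<close>. The l1 growth of the orbit and the bound on \<open>u\<close> make it tend
  to 0.\<close>

lemma resolvent_sums:
  assumes u: "\<And>i. u i = e0 i + z * J u i" and bound: "\<And>i. \<bar>u i\<bar> \<le> C"
    and z: "\<bar>z\<bar> * (3 * B) < 1"
  shows "(\<lambda>k. z ^ k * orbit k 0) sums u 0"
proof -
  define ip where "ip k = (\<Sum>i\<le>Suc k. orbit k i * u i)" for k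
  have step: "ip k = orbit k 0 + z * ip (Suc k)" for k
  proof -
    have "ip k = (\<Sum>i\<le>Suc (Suc k). orbit k i * u i)" by (simp add: ip_def orbit_eq_0)
    also have "\<dots> = (\<Sum>i\<le>Suc (Suc k). orbit k i * e0 i) + z * (\<Sum>i\<le>Suc (Suc k). orbit k i * J u i)"
    proof -
      have "orbit k i * u i = orbit k i * e0 i + z * (orbit k i * J u i)" for i
        using arg_cong[OF u[of i], of "\<lambda>x. orbit k i * x"] by (simp only: distrib_left mult.left_commute)
      then show ?thesis by (simp only: sum.distrib flip: sum_distrib_left)
    qed
    also have "(\<Sum>i\<le>Suc (Suc k). orbit k i * e0 i) = orbit k 0"
      by (simp add: e0_def if_distrib[of "\<lambda>c. _ * c"] sum.atMost_Suc_shift del: sum.atMost_Suc cong: if_cong)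
    also have "(\<Sum>i\<le>Suc (Suc k). orbit k i * J u i) = ip (Suc k)"
      using jacobi_green[of "orbit k" u "Suc (Suc k)"] unfolding ip_def orbit_Suc
      by (simp add: orbit_eq_0 del: sum.atMost_Suc)
    finally show ?thesis .
  qed
  have rem: "u 0 - (\<Sum>k<n. z ^ k * orbit k 0) = z ^ n * ip n" for n
  proof (induction n)
    case 0
    then show ?case by (simp add: ip_def orbit_0 e0_def)
  next
    case (Suc n)
    then show ?case using step[of n] by (simp add: algebra_simps)
  qed
  have "\<bar>ip n\<bar> \<le> C * (3 * B) ^ n" for n
  proof -
    have C: "C \<ge> 0" using bound[of 0] by linarith
    have "\<bar>ip n\<bar> \<le> (\<Sum>i\<le>Suc n. \<bar>orbit n i\<bar> * C)"
      unfolding ip_def by (rule order.trans[OF sum_abs], unfold abs_mult, intro sum_mono mult_left_mono bound) auto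
    also have "\<dots> \<le> (3 * B) ^ n * C"
      unfolding sum_distrib_right[symmetric] using C by (intro mult_right_mono orbit_l1) auto
    finally show ?thesis by (simp add: mult.commute)
  qed
  then have bnd: "norm (u 0 - (\<Sum>k<n. z ^ k * orbit k 0)) \<le> C * (\<bar>z\<bar> * (3 * B)) ^ n" for n
    unfolding rem real_norm_def abs_mult power_abs[symmetric] power_mult_distrib
    by (metis abs_ge_zero mult.left_commute mult_left_mono zero_le_power)
  have lim: "(\<lambda>n. C * (\<bar>z\<bar> * (3 * B)) ^ n) \<longlonglongrightarrow> 0"
    using z B_nonneg by (intro tendsto_mult_right_zero LIMSEQ_power_zero) auto
  have "(\<lambda>n. u 0 - (\<Sum>k<n. z ^ k * orbit k 0)) \<longlonglongrightarrow> 0"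
    by (rule Lim_null_comparison[OF always_eventually[OF allI[OF bnd]] lim])
  from tendsto_diff[OF tendsto_const[of "u 0"] this] show ?thesis
    unfolding sums_def by simp
qed

end

section \<open>Moment generating functions\<close>

text \<open>The series converges by comparison with the exponential series. Its limit is identified
  along the partial sums up to an even degree only: there the Taylor remainder involves an absolute
  moment of even order, which is an ordinary moment and hence covered by the bound.\<close>

lemma (in real_distribution) char_sums_moments:
  assumes int: "\<And>k. integrable M (\<lambda>x. x ^ k)"
    and bound: "\<And>k. \<bar>\<integral>x. x ^ k \<partial>M\<bar> \<le> C * R ^ k" and "R > 0"
  shows "(\<lambda>k. (\<i> * complex_of_real t) ^ k / fact k * (\<integral>x. x ^ k \<partial>M)) sums char M t"
proof -
  let ?S = "\<lambda>n. \<Sum>k<n. (\<i> * complex_of_real t) ^ k / fact k * (\<integral>x. x ^ k \<partial>M)"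
  have "summable (\<lambda>k. (\<i> * complex_of_real t) ^ k / fact k * (\<integral>x. x ^ k \<partial>M))"
  proof (rule summable_comparison_test', rule summable_mult)
    show "summable (\<lambda>k. inverse (fact k) * (\<bar>t\<bar> * R) ^ k)" by (rule summable_exp)
    fix k
    have "norm ((\<i> * complex_of_real t) ^ k / fact k * (\<integral>x. x ^ k \<partial>M))
        = inverse (fact k) * \<bar>t\<bar> ^ k * \<bar>\<integral>x. x ^ k \<partial>M\<bar>"
      by (simp add: norm_mult norm_divide norm_power norm_inverse divide_inverse mult.commute)
    also have "\<dots> \<le> inverse (fact k) * \<bar>t\<bar> ^ k * (C * R ^ k)"
      by (intro mult_left_mono bound) auto
    finally show "norm ((\<i> * complex_of_real t) ^ k / fact k * (\<integral>x. x ^ k \<partial>M))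
        \<le> C * (inverse (fact k) * (\<bar>t\<bar> * R) ^ k)"
      by (simp add: power_mult_distrib mult_ac)
  qed
  then obtain l where l: "?S \<longlonglongrightarrow> l" by (auto simp: summable_def sums_def)
  have even: "\<bar>t\<bar> ^ n * expectation (\<lambda>x. \<bar>x\<bar> ^ n) \<le> C * (\<bar>t\<bar> * R) ^ n" if "even n" for n
  proof -
    have "expectation (\<lambda>x. \<bar>x\<bar> ^ n) \<le> C * R ^ n"
      using bound[of n] that by (simp add: power_even_abs)
    then show ?thesis
      by (simp add: power_mult_distrib mult.left_commute[of C] mult_left_mono)
  qed
  have "(\<lambda>n. norm (char M t - ?S (Suc (2 * n)))) \<longlonglongrightarrow> 0"
  proof (rule Lim_null_comparison)
    have "norm (norm (char M t - ?S (Suc (2 * n)))) \<le> 2 * C * ((\<bar>t\<bar> * R) ^ (2 * n) / fact (2 * n))" for n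
    proof -
      have "norm (char M t - ?S (Suc (2 * n))) \<le> 2 * \<bar>t\<bar> ^ (2 * n) / fact (2 * n) * expectation (\<lambda>x. \<bar>x\<bar> ^ (2 * n))"
        using char_approx1[of "2 * n" t] int unfolding lessThan_Suc_atMost by blast
      also have "\<dots> = 2 / fact (2 * n) * (\<bar>t\<bar> ^ (2 * n) * expectation (\<lambda>x. \<bar>x\<bar> ^ (2 * n)))" by simp
      also have "\<dots> \<le> 2 / fact (2 * n) * (C * (\<bar>t\<bar> * R) ^ (2 * n))"
        by (intro mult_left_mono even) auto
      finally show ?thesis by simp
    qed
    then show "eventually (\<lambda>n. norm (norm (char M t - ?S (Suc (2 * n))))
        \<le> 2 * C * ((\<bar>t\<bar> * R) ^ (2 * n) / fact (2 * n))) sequentially"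
      by (rule always_eventually[OF allI])
    have "(\<lambda>n. (\<bar>t\<bar> * R) ^ n / fact n) \<longlonglongrightarrow> 0"
      using summable_LIMSEQ_zero[OF summable_exp[of "\<bar>t\<bar> * R"]] by (simp add: field_simps)
    from LIMSEQ_subseq_LIMSEQ[OF this, of "\<lambda>n. 2 * n"]
    have "(\<lambda>n. (\<bar>t\<bar> * R) ^ (2 * n) / fact (2 * n)) \<longlonglongrightarrow> 0"
      by (simp add: strict_mono_def comp_def)
    then show "(\<lambda>n. 2 * C * ((\<bar>t\<bar> * R) ^ (2 * n) / fact (2 * n))) \<longlonglongrightarrow> 0"
      by (rule tendsto_mult_right_zero)
  qed
  then have "(\<lambda>n. char M t - ?S (Suc (2 * n))) \<longlonglongrightarrow> 0" by (rule tendsto_norm_zero_cancel)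
  from tendsto_diff[OF tendsto_const[of "char M t"] this]
  have "(\<lambda>n. ?S (Suc (2 * n))) \<longlonglongrightarrow> char M t" by simp
  moreover have "(\<lambda>n. ?S (Suc (2 * n))) \<longlonglongrightarrow> l"
    using LIMSEQ_subseq_LIMSEQ[OF l, of "\<lambda>n. Suc (2 * n)"]
    by (simp add: strict_mono_def comp_def del: sum.lessThan_Suc)
  ultimately have "char M t = l" by (rule LIMSEQ_unique)
  then show ?thesis using l by (simp add: sums_def)
qed

lemma measure_eq_of_moments:
  assumes "real_distribution M" "real_distribution N"
    and "\<And>k. integrable M (\<lambda>x. x ^ k)" "\<And>k. integrable N (\<lambda>x. x ^ k)"
    and eq: "\<And>k. (\<integral>x. x ^ k \<partial>M) = (\<integral>x. x ^ k \<partial>N)"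
    and bound: "\<And>k. \<bar>\<integral>x. x ^ k \<partial>M\<bar> \<le> C * R ^ k" and "R > 0"
  shows "M = N"
proof (rule Levy_uniqueness[OF assms(1,2)], rule ext)
  fix t
  have "(\<lambda>k. (\<i> * complex_of_real t) ^ k / fact k * (\<integral>x. x ^ k \<partial>M)) sums char M t"
    by (rule real_distribution.char_sums_moments) (use assms in auto)
  moreover have "(\<lambda>k. (\<i> * complex_of_real t) ^ k / fact k * (\<integral>x. x ^ k \<partial>N)) sums char N t"
    by (rule real_distribution.char_sums_moments) (use assms in \<open>auto simp flip: eq\<close>)
  ultimately show "char M t = char N t" unfolding eq by (rule sums_unique2)
qed

section \<open>Power series and uniqueness of the measure\<close>

lemma powser_eq_0:
  fixes a :: "nat \<Rightarrow> real"
  assumes "\<epsilon> > 0" and sums: "\<And>z. \<bar>z\<bar> < \<epsilon> \<Longrightarrow> (\<lambda>k. a k * z ^ k) sums 0"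
  shows "a n = 0"
proof (rule ccontr)
  assume "a n \<noteq> 0"
  \<comment> \<open>Division by \<open>z ^ m\<close>, with \<open>m\<close> the index of the first
    nonzero coefficient, and the limit at 0 give \<open>a m = 0\<close>.\<close>
  define m where "m = (LEAST n. a n \<noteq> 0)"
  have m: "a m \<noteq> 0" "\<And>k. k < m \<Longrightarrow> a k = 0"
    using LeastI[of "\<lambda>n. a n \<noteq> 0" n] \<open>a n \<noteq> 0\<close> not_less_Least unfolding m_def by blast+
  have shifted: "(\<lambda>k. a (k + m) * z ^ k) sums 0" if "\<bar>z\<bar> < \<epsilon>" "z \<noteq> 0" for z
  proof -
    have "(\<lambda>k. a (k + m) * z ^ (k + m)) sums 0"
      using sums_split_initial_segment[OF sums[OF that(1)], of m] m(2) by simp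
    from sums_mult[OF this, of "1 / z ^ m"] show ?thesis
      using that by (simp add: power_add)
  qed
  have "((\<lambda>_. 0) \<longlongrightarrow> a (0 + m)) (at (0::real))"
    using shifted by (intro powser_limit_0_strong[OF \<open>\<epsilon> > 0\<close>]) auto
  then have "0 = a (0 + m)" by (rule LIM_unique[OF tendsto_const])
  then show False using m(1) by simp
qed

lemma is_mgf_of_moments_eq:
  assumes "is_mgf_of \<phi> \<nu>" "is_mgf_of \<phi> \<nu>'"
  shows "(\<integral>y. y ^ k \<partial>\<nu>) = (\<integral>y. y ^ k \<partial>\<nu>')"
proof -
  obtain \<epsilon> \<epsilon>' where e: "\<epsilon> > 0" "\<epsilon>' > 0"
    and s: "\<And>z. \<bar>z\<bar> < \<epsilon> \<Longrightarrow> (\<lambda>k. z ^ k * (\<integral>y. y ^ k \<partial>\<nu>)) sums \<phi> z"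
      "\<And>z. \<bar>z\<bar> < \<epsilon>' \<Longrightarrow> (\<lambda>k. z ^ k * (\<integral>y. y ^ k \<partial>\<nu>')) sums \<phi> z"
    using assms by (auto simp: is_mgf_of_def)
  have "(\<integral>y. y ^ k \<partial>\<nu>) - (\<integral>y. y ^ k \<partial>\<nu>') = 0"
  proof (rule powser_eq_0[where \<epsilon> = "min \<epsilon> \<epsilon>'"])
    fix z :: real assume "\<bar>z\<bar> < min \<epsilon> \<epsilon>'"
    then show "(\<lambda>k. ((\<integral>y. y ^ k \<partial>\<nu>) - (\<integral>y. y ^ k \<partial>\<nu>')) * z ^ k) sums 0"
      using sums_diff[OF s(1)[of z] s(2)[of z]] by (simp add: algebra_simps)
  qed (use e in auto)
  then show ?thesis by simp
qed

text \<open>The terms of a convergent series are bounded, so convergence at the single point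
  \<open>\<epsilon> / 2\<close> already gives the exponential moment bound for
  \<open>measure_eq_of_moments\<close>.\<close>

lemma is_mgf_of_unique:
  assumes "is_mgf_of \<phi> \<nu>" "is_mgf_of \<phi> \<nu>'"
  shows "\<nu>' = \<nu>"
proof -
  have dist: "real_distribution \<mu>" if "is_mgf_of \<phi> \<mu>" for \<mu>
    using that by (simp add: is_mgf_of_def real_distribution_def real_distribution_axioms_def)
  obtain \<epsilon> where e: "\<epsilon> > 0"
    and s: "\<And>z. \<bar>z\<bar> < \<epsilon> \<Longrightarrow> (\<lambda>k. z ^ k * (\<integral>y. y ^ k \<partial>\<nu>)) sums \<phi> z"
    using assms by (auto simp: is_mgf_of_def)
  define z where "z = \<epsilon> / 2"
  have z: "z > 0" "\<bar>z\<bar> < \<epsilon>" using e by (auto simp: z_def)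
  have "Bseq (\<lambda>k. z ^ k * (\<integral>y. y ^ k \<partial>\<nu>))"
    by (intro convergent_imp_Bseq summable_LIMSEQ_zero[THEN convergentI] sums_summable[OF s] z)
  then obtain C where "\<And>k. norm (z ^ k * (\<integral>y. y ^ k \<partial>\<nu>)) \<le> C" by (auto simp: Bseq_def)
  then have "\<bar>\<integral>y. y ^ k \<partial>\<nu>\<bar> \<le> C * (1 / z) ^ k" for k
    using z by (simp add: abs_mult power_divide field_simps)
  then have "\<nu> = \<nu>'"
    using z assms
    by (intro measure_eq_of_moments[where C = C and R = "1 / z"] dist is_mgf_of_moments_eq[OF assms])
       (auto simp: is_mgf_of_def)
  then show ?thesis ..
qed

lemma has_fps_expansion_0_imp:
  fixes F :: "real fps"
  assumes "(\<lambda>_. 0) has_fps_expansion F"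
  shows "F = 0"
proof (rule fps_ext)
  fix n
  have "fps_conv_radius F > 0" and ev: "eventually (\<lambda>z. eval_fps F z = 0) (nhds 0)"
    using assms by (auto simp: has_fps_expansion_def)
  then have "eventually (\<lambda>z. z \<in> eball 0 (fps_conv_radius F)) (nhds 0)"
    by (intro eventually_nhds_in_open) (auto simp: zero_ereal_def)
  with ev have "eventually (\<lambda>z. (\<lambda>k. fps_nth F k * z ^ k) sums 0) (nhds 0)"
    by eventually_elim (metis sums_eval_fps in_eball_iff dist_0_norm)
  then obtain \<epsilon> where "\<epsilon> > 0" "\<And>z. \<bar>z\<bar> < \<epsilon> \<Longrightarrow> (\<lambda>k. fps_nth F k * z ^ k) sums 0"
    by (auto simp: eventually_nhds_metric)
  then show "fps_nth F n = fps_nth 0 n"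
    using powser_eq_0[of \<epsilon> "fps_nth F" n] by simp
qed

lemma is_mgf_of_fps:
  assumes "is_mgf_of \<phi> \<nu>"
  shows "\<phi> has_fps_expansion Abs_fps (\<lambda>k. \<integral>y. y ^ k \<partial>\<nu>)"
proof -
  let ?M = "Abs_fps (\<lambda>k. \<integral>y. y ^ k \<partial>\<nu>)"
  obtain \<epsilon> where e: "\<epsilon> > 0"
    and s: "\<And>z. \<bar>z\<bar> < \<epsilon> \<Longrightarrow> (\<lambda>k. fps_nth ?M k * z ^ k) sums \<phi> z"
    using assms by (auto simp: is_mgf_of_def mult.commute)
  have "ereal (norm (\<epsilon> / 2)) \<le> fps_conv_radius ?M"
    unfolding fps_conv_radius_def using e by (intro conv_radius_geI sums_summable[OF s]) auto
  moreover have "0 < ereal (norm (\<epsilon> / 2))" using e by simp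
  ultimately have "fps_conv_radius ?M > 0" by (rule less_le_trans[rotated])
  moreover have "eventually (\<lambda>z. eval_fps ?M z = \<phi> z) (nhds 0)"
    unfolding eventually_nhds_metric eval_fps_def using e s
    by (intro exI[of _ \<epsilon>]) (auto intro: sums_unique[symmetric])
  ultimately show ?thesis by (simp add: has_fps_expansion_def)
qed

text \<open>Turns the functional equation near 0 into an identity of formal power series, in exactly
  the form that \<open>commutator_eqs_dquot\<close> takes as a hypothesis.\<close>

lemma mgf_fps_equation:
  fixes \<phi> :: "real \<Rightarrow> real"
  assumes mgf: "is_mgf_of \<phi> \<nu>" and "\<delta> > 0"
    and quad: "\<And>z. \<bar>z\<bar> < \<delta> \<Longrightarrow> (z\<^sup>2 + \<eta> * z + \<sigma>) * (t + \<tau>) * (\<phi> z)\<^sup>2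
        + ((\<theta> - t * \<eta>) * z - 2 * t * \<sigma> - \<sigma> * \<tau> - 1) * \<phi> z + t * \<sigma> + 1 = 0"
  defines "M \<equiv> Abs_fps (\<lambda>k. \<integral>y. y ^ k \<partial>\<nu>)"
  shows "(fps_X * fps_X + fps_const \<eta> * fps_X + fps_const \<sigma>) * (fps_const t + fps_const \<tau>) * (M * M)
      + ((fps_const \<theta> - fps_const t * fps_const \<eta>) * fps_X - fps_const t * fps_const \<sigma>
         - fps_const t * fps_const \<sigma> - fps_const \<sigma> * fps_const \<tau> - 1) * M
      + fps_const t * fps_const \<sigma> + 1 = 0" (is "?F = 0")
proof (rule has_fps_expansion_0_imp)
  have "(\<lambda>z. (z * z + \<eta> * z + \<sigma>) * (t + \<tau>) * (\<phi> z * \<phi> z)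
      + ((\<theta> - t * \<eta>) * z - t * \<sigma> - t * \<sigma> - \<sigma> * \<tau> - 1) * \<phi> z + t * \<sigma> + 1) has_fps_expansion ?F"
    unfolding M_def by (intro fps_expansion_intros is_mgf_of_fps[OF mgf])
  moreover have "eventually (\<lambda>z. (z * z + \<eta> * z + \<sigma>) * (t + \<tau>) * (\<phi> z * \<phi> z)
      + ((\<theta> - t * \<eta>) * z - t * \<sigma> - t * \<sigma> - \<sigma> * \<tau> - 1) * \<phi> z + t * \<sigma> + 1 = 0) (nhds 0)"
    unfolding eventually_nhds_metric using \<open>\<delta> > 0\<close> quad
    by (intro exI[of _ \<delta>]) (simp add: power2_eq_square algebra_simps)
  ultimately show "(\<lambda>_. 0) has_fps_expansion ?F"
    by (auto simp: has_fps_expansion_def elim: eventually_elim2)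
qed

text \<open>The resolvent of a Jacobi matrix that is constant from the second row on is geometric.\<close>
lemma jacobi_mgf:
  fixes \<phi> :: "real \<Rightarrow> real" and d a g b :: real
  assumes g: "g > 0" and b: "b > 0"
    and \<phi>: "isCont \<phi> 0" "\<phi> 0 = 1" and "\<delta> > 0"
    and quad: "\<And>z. \<bar>z\<bar> < \<delta> \<Longrightarrow>
      b * ((1 - d * z) * \<phi> z - 1)\<^sup>2 - g * (1 - a * z) * \<phi> z * ((1 - d * z) * \<phi> z - 1)
      + g\<^sup>2 * z\<^sup>2 * (\<phi> z)\<^sup>2 = 0"
  shows "\<exists>\<nu>. is_mgf_of \<phi> \<nu>"
proof -
  define as where "as i = (if i = 0 then d else a)" for i :: nat
  define cs where "cs i = (if i = 0 then sqrt g else sqrt b)" for i :: nat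
  define B where "B = \<bar>d\<bar> + \<bar>a\<bar> + sqrt g + sqrt b"
  interpret bounded_jacobi as cs B
    by unfold_locales (use g b in \<open>auto simp: as_def cs_def B_def\<close>)
  \<comment> \<open>Write \<open>\<phi> = 1 / (1 - d z - g z^2 S)\<close>, where \<open>S\<close>
    belongs to the matrix without its first row and column. Then \<open>y = g z^2 S \<phi>\<close>,
    and \<open>w = sqrt b z S\<close> is the ratio of the geometric resolvent.\<close>
  define y where "y z = (1 - d * z) * \<phi> z - 1" for z
  define w where "w z = sqrt b * y z / (g * z * \<phi> z)" for z
  define \<rho> where "\<rho> z = sqrt b * y z / (g * \<phi> z)" for z
  \<comment> \<open>The quadratic equation for \<open>w\<close> has two roots with product 1.
    Continuity of \<open>\<phi>\<close> at 0 selects the one with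
    \<open>\<bar>w\<bar> \<le> 1\<close>: it forces \<open>\<rho>\<close> and thus \<open>T\<close>
    to tend to 0, while \<open>\<bar>w\<bar> > 1\<close> would imply
    \<open>\<bar>w\<bar> \<le> \<bar>w\<bar> * T\<close>.\<close>
  define T where "T z = \<bar>z\<bar> * (sqrt b + \<bar>a\<bar>) + sqrt b * \<bar>\<rho> z\<bar>" for z
  have "(\<phi> \<longlongrightarrow> 1) (at 0)" using \<phi> by (simp add: isCont_def)
  then have "(T \<longlongrightarrow> \<bar>0\<bar> * (sqrt b + \<bar>a\<bar>) + sqrt b * \<bar>sqrt b * ((1 - d * 0) * 1 - 1) / (g * 1)\<bar>) (at 0)"
    unfolding T_def \<rho>_def y_def using g by (intro tendsto_intros) auto
  then have "eventually (\<lambda>z. T z < 1) (at 0)" by (intro order_tendstoD) auto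
  moreover have "eventually (\<lambda>z. \<phi> z > 0) (at 0)"
    using \<open>(\<phi> \<longlongrightarrow> 1) (at 0)\<close> by (intro order_tendstoD) auto
  moreover have "((\<lambda>z. \<bar>z\<bar> * (3 * B)) \<longlongrightarrow> \<bar>0\<bar> * (3 * B)) (at 0)" by (intro tendsto_intros)
  then have "eventually (\<lambda>z. \<bar>z\<bar> * (3 * B) < 1) (at 0)" by (intro order_tendstoD) auto
  moreover have "((\<lambda>z. \<bar>z\<bar>) \<longlongrightarrow> \<bar>0::real\<bar>) (at 0)" by (intro tendsto_intros)
  then have "eventually (\<lambda>z. \<bar>z\<bar> < \<delta>) (at 0)" using \<open>\<delta> > 0\<close> by (intro order_tendstoD) auto
  ultimately have "eventually (\<lambda>z. T z < 1 \<and> \<phi> z > 0 \<and> \<bar>z\<bar> * (3 * B) < 1 \<and> \<bar>z\<bar> < \<delta>) (at 0)"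
    by eventually_elim simp
  then obtain \<epsilon> where \<epsilon>: "\<epsilon> > 0"
    and small: "\<And>z. z \<noteq> 0 \<Longrightarrow> \<bar>z\<bar> < \<epsilon> \<Longrightarrow> T z < 1 \<and> \<phi> z > 0 \<and> \<bar>z\<bar> * (3 * B) < 1 \<and> \<bar>z\<bar> < \<delta>"
    by (auto simp: eventually_at)
  have sums: "(\<lambda>k. z ^ k * orbit k 0) sums \<phi> z" if z: "\<bar>z\<bar> < \<epsilon>" for z
  proof (cases "z = 0")
    case True
    have "(\<lambda>k. 0 ^ k * orbit k 0) sums (0 ^ 0 * orbit 0 0)"
      using sums_finite[of "{0::nat}" "\<lambda>k. 0 ^ k * orbit k 0"] by simp
    then show ?thesis by (simp add: True \<phi> orbit_0 e0_def)
  next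
    case False
    have s: "T z < 1" "\<phi> z > 0" "\<bar>z\<bar> * (3 * B) < 1" "\<bar>z\<bar> < \<delta>"
      using small[OF False z] by auto
    have rb: "sqrt b > 0" "sqrt b * sqrt b = b" and rg: "sqrt g > 0" "sqrt g * sqrt g = g"
      using g b by auto
    have zw: "z * w z = \<rho> z" using False by (simp add: w_def \<rho>_def)
    have W: "w z = z * (sqrt b + a * w z + sqrt b * (w z)\<^sup>2)"
    proof -
      define r where "r = w z / sqrt b"
      have w: "w z = sqrt b * r" using rb by (simp add: r_def)
      have y: "y z = g * z * \<phi> z * r" using s g False rb by (simp add: r_def w_def)
      have "b * (y z)\<^sup>2 - g * (1 - a * z) * \<phi> z * y z + g\<^sup>2 * z\<^sup>2 * (\<phi> z)\<^sup>2 = 0"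
        using quad[OF s(4)] by (simp add: y_def)
      \<comment> \<open>The hypothesis \<open>quad\<close> factors once \<open>y\<close> is
        expressed through \<open>r\<close>; the remaining factor is the equation of the constant
        tail of the matrix.\<close>
      then have "(g\<^sup>2 * z * (\<phi> z)\<^sup>2) * (b * z * r\<^sup>2 - (1 - a * z) * r + z) = 0"
        unfolding y by (simp add: power2_eq_square algebra_simps)
      then have "b * z * r\<^sup>2 - (1 - a * z) * r + z = 0" using g s False by simp
      then have r: "r = z * (1 + a * r + b * r\<^sup>2)" by (simp add: algebra_simps)
      have "z * (sqrt b + a * w z + sqrt b * (w z)\<^sup>2) = sqrt b * (z * (1 + a * r + (sqrt b * sqrt b) * r\<^sup>2))"
        unfolding w by (simp add: power2_eq_square algebra_simps)
      then show ?thesis unfolding rb(2) r[symmetric] w by simp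
    qed
    have w_le: "\<bar>w z\<bar> \<le> 1"
    proof (rule ccontr)
      assume "\<not> \<bar>w z\<bar> \<le> 1"
      then have w: "\<bar>w z\<bar> > 1" by simp
      have "\<bar>w z\<bar> = \<bar>z * sqrt b + w z * (a * z + sqrt b * \<rho> z)\<bar>"
        by (subst W) (simp add: zw[symmetric] power2_eq_square algebra_simps)
      also have "\<dots> \<le> \<bar>z\<bar> * sqrt b + \<bar>w z\<bar> * (\<bar>a\<bar> * \<bar>z\<bar> + sqrt b * \<bar>\<rho> z\<bar>)"
      proof -
        have "\<bar>a * z + sqrt b * \<rho> z\<bar> \<le> \<bar>a\<bar> * \<bar>z\<bar> + sqrt b * \<bar>\<rho> z\<bar>"
          using abs_triangle_ineq[of "a * z" "sqrt b * \<rho> z"] rb by (simp add: abs_mult)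
        then have "\<bar>w z * (a * z + sqrt b * \<rho> z)\<bar> \<le> \<bar>w z\<bar> * (\<bar>a\<bar> * \<bar>z\<bar> + sqrt b * \<bar>\<rho> z\<bar>)"
          unfolding abs_mult[of "w z"] by (intro mult_left_mono) auto
        moreover have "\<bar>z * sqrt b\<bar> = \<bar>z\<bar> * sqrt b" using rb by (simp add: abs_mult)
        ultimately show ?thesis using abs_triangle_ineq[of "z * sqrt b" "w z * (a * z + sqrt b * \<rho> z)"]
          by linarith
      qed
      also have "\<dots> \<le> \<bar>w z\<bar> * (\<bar>z\<bar> * sqrt b) + \<bar>w z\<bar> * (\<bar>a\<bar> * \<bar>z\<bar> + sqrt b * \<bar>\<rho> z\<bar>)"
        using w rb mult_right_mono[of 1 "\<bar>w z\<bar>" "\<bar>z\<bar> * sqrt b"] by simp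
      also have "\<dots> = \<bar>w z\<bar> * T z" by (simp add: T_def algebra_simps)
      also have "\<dots> < \<bar>w z\<bar> * 1" using w s by (intro mult_strict_left_mono) auto
      finally show False by simp
    qed
    \<comment> \<open>The link between indices 0 and 1 is \<open>sqrt g\<close> instead of
      \<open>sqrt b\<close>; \<open>\<kappa>\<close> is chosen so that row 1 still fits the
      geometric pattern.\<close>
    define \<kappa> where "\<kappa> = sqrt g / sqrt b * \<phi> z"
    have \<kappa>: "sqrt b * \<kappa> = sqrt g * \<phi> z" using rb by (simp add: \<kappa>_def)
    define u where "u i = (if i = 0 then \<phi> z else \<kappa> * w z ^ i)" for i :: nat
    have "(\<lambda>k. z ^ k * orbit k 0) sums u 0"
    proof (rule resolvent_sums)
      fix i
      show "\<bar>u i\<bar> \<le> \<bar>\<phi> z\<bar> + \<bar>\<kappa>\<bar>"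
      proof -
        have "\<bar>w z\<bar> ^ i \<le> 1" using w_le by (intro power_le_one) auto
        then have "\<bar>\<kappa>\<bar> * \<bar>w z\<bar> ^ i \<le> \<bar>\<kappa>\<bar> * 1" by (rule mult_left_mono) simp
        then show ?thesis by (auto simp: u_def abs_mult power_abs)
      qed
      show "u i = e0 i + z * jacobi as cs u i"
      proof (cases i)
        case 0
        have "z * (sqrt g * (\<kappa> * w z)) = sqrt g * \<kappa> * \<rho> z" by (simp add: zw[symmetric])
        also have "\<dots> = y z"
          using rb rg s g by (simp add: \<kappa>_def \<rho>_def flip: mult.assoc)
        finally show ?thesis
          using 0 by (simp add: u_def e0_def as_def cs_def y_def algebra_simps)
      next
        case (Suc j)
        have step: "\<kappa> * w z ^ Suc j = z * (a * (\<kappa> * w z ^ Suc j) + sqrt b * (\<kappa> * w z ^ Suc (Suc j))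
            + sqrt b * \<kappa> * w z ^ j)"
        proof -
          have "\<kappa> * w z ^ Suc j = \<kappa> * w z ^ j * w z" by simp
          also have "\<dots> = \<kappa> * w z ^ j * (z * (sqrt b + a * w z + sqrt b * (w z)\<^sup>2))"
            using W by simp
          also have "\<dots> = z * (a * (\<kappa> * w z ^ Suc j) + sqrt b * (\<kappa> * w z ^ Suc (Suc j))
            + sqrt b * \<kappa> * w z ^ j)"
            by (simp add: power2_eq_square algebra_simps)
          finally show ?thesis .
        qed
        show ?thesis
        proof (cases j)
          case 0
          then show ?thesis using Suc step \<kappa> by (simp add: u_def e0_def as_def cs_def)
        next
          case (Suc k)
          then show ?thesis using \<open>i = Suc j\<close> step
            by (simp only: jacobi_Suc u_def e0_def as_def cs_def nat.simps if_False add_0_left mult.assoc)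
        qed
      qed
    qed (rule s)
    then show ?thesis by (simp add: u_def)
  qed
  obtain \<nu> where "prob_space \<nu>" "sets \<nu> = sets borel"
    "\<And>k. integrable \<nu> (\<lambda>x. x ^ k)" "\<And>k. (\<integral>x. x ^ k \<partial>\<nu>) = orbit k 0"
    using favard by blast
  then show ?thesis using \<epsilon> sums unfolding is_mgf_of_def by (intro exI[of _ \<nu>]) auto
qed

section \<open>The generator of a quadratic harness\<close>

lemma smult_sum: "smult c (sum f A) = (\<Sum>x\<in>A. smult c (f x))"
  by (induction A rule: infinite_finite_induct) (auto simp: smult_add_right)

lemma qmul_apply: "qmul P Q k = qapp P (Q k)"
  by (simp add: qmul_def qapp_def)

lemma qapp_altdef:
  assumes "degree p \<le> N"
  shows "qapp P p = (\<Sum>j\<le>N. smult (coeff p j) (P j))"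
  unfolding qapp_def
  by (rule sum.mono_neutral_left) (use assms in \<open>auto simp: coeff_eq_0\<close>)

lemma qapp_0 [simp]: "qapp P 0 = 0"
  by (simp add: qapp_def)

lemma qapp_add: "qapp P (p + q) = qapp P p + qapp P q"
proof -
  define N where "N = max (degree p) (degree q)"
  have "degree p \<le> N" "degree q \<le> N" "degree (p + q) \<le> N"
    by (auto simp: N_def degree_add_le)
  then show ?thesis by (simp add: qapp_altdef[of _ N] smult_add_left sum.distrib)
qed

lemma qapp_smult: "qapp P (smult c p) = smult c (qapp P p)"
proof -
  have "degree (smult c p) \<le> degree p" by simp
  then show ?thesis by (simp add: qapp_altdef[of _ "degree p"] smult_sum)
qed

lemma qapp_minus: "qapp P (- p) = - qapp P p"
  using qapp_smult[of P "-1" p] by simp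

lemma qapp_diff: "qapp P (p - q) = qapp P p - qapp P q"
  using qapp_add[of P p "- q"] by (simp add: qapp_minus)

lemma qapp_sum: "qapp P (sum f A) = (\<Sum>x\<in>A. qapp P (f x))"
  by (induction A rule: infinite_finite_induct) (auto simp: qapp_add)

lemma qapp_monom [simp]: "qapp P (monom c k) = smult c (P k)"
  by (subst qapp_altdef[of _ k])
     (auto simp: degree_monom_le if_distrib[of "\<lambda>c. smult c _"] cong: if_cong)

lemma qapp_1 [simp]: "qapp P 1 = P 0"
  using qapp_monom[of P 1 0] by simp

lemma qapp_qmul: "qapp (qmul P Q) p = qapp P (qapp Q p)"
  by (simp add: qapp_def[of _ p] qapp_sum qapp_smult qmul_apply)

lemma qapp_qadd: "qapp (qadd P Q) p = qapp P p + qapp Q p"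
  by (simp add: qapp_def qadd_def smult_add_right sum.distrib)

lemma qapp_qsub: "qapp (qsub P Q) p = qapp P p - qapp Q p"
  by (simp add: qapp_def qsub_def smult_diff_right sum_subtractf)

lemma qapp_qscale: "qapp (qscale c P) p = smult c (qapp P p)"
  by (simp add: qapp_def qscale_def smult_sum mult.commute)

lemma qapp_qE: "qapp qE p = p"
  by (simp add: qapp_def qE_def smult_monom poly_as_sum_of_monoms)

lemma qapp_qF: "qapp qF p = pCons 0 p"
proof -
  have "qapp qF p = (\<Sum>j\<le>degree p. pCons 0 (monom (coeff p j) j))"
    by (simp add: qapp_def qF_def smult_monom monom_Suc)
  also have "\<dots> = (\<Sum>j\<le>degree p. [:0, 1:] * monom (coeff p j) j)" by simp
  also have "\<dots> = [:0, 1:] * p"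
    by (simp only: sum_distrib_left[symmetric] poly_as_sum_of_monoms)
  finally show ?thesis by simp
qed

text \<open>The equation obtained from the q-commutation relation of \<open>X\<close> and \<open>F\<close> upon conjugation by \<open>P 0 s\<close>:
  \<open>H\<close> is the commutator of the generator at time \<open>s\<close> with multiplication by \<open>x\<close>.\<close>
definition commutator_eqs :: "real \<Rightarrow> real \<Rightarrow> real \<Rightarrow> real \<Rightarrow> real \<Rightarrow> qseq \<Rightarrow> bool" where
  "commutator_eqs \<eta> \<theta> \<sigma> \<tau> s H \<longleftrightarrow> H 0 = 0 \<and>
     (\<forall>n. smult (1 + \<sigma> * s) (H (Suc n)) =
        monom 1 n + monom \<eta> (Suc n) + monom \<sigma> (Suc (Suc n)) + smult (\<theta> - s * \<eta>) (H n)
        - smult (\<sigma> * (\<tau> + s)) (pCons 0 (H n)) + smult ((s + \<tau>) * (1 + \<sigma> * s)) (qapp H (H n)))"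

text \<open>The term \<open>qapp H (H n)\<close> itself contains \<open>H (Suc n)\<close>, weighted
  by the top coefficient of \<open>H n\<close>. Moving this part to the left turns the quadratic
  equation into a recursion.\<close>

lemma commutator_step:
  assumes eqs: "commutator_eqs \<eta> \<theta> \<sigma> \<tau> s H" and deg: "degree (H n) \<le> Suc n"
  shows "smult ((1 + \<sigma> * s) * (1 - (s + \<tau>) * coeff (H n) (Suc n))) (H (Suc n)) =
        monom 1 n + monom \<eta> (Suc n) + monom \<sigma> (Suc (Suc n)) + smult (\<theta> - s * \<eta>) (H n)
        - smult (\<sigma> * (\<tau> + s)) (pCons 0 (H n))
        + smult ((s + \<tau>) * (1 + \<sigma> * s)) (\<Sum>j\<le>n. smult (coeff (H n) j) (H j))"
proof -
  have split: "qapp H (H n) =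
      smult (coeff (H n) (Suc n)) (H (Suc n)) + (\<Sum>j\<le>n. smult (coeff (H n) j) (H j))"
    using deg by (simp add: qapp_altdef[of _ "Suc n"] add.commute)
  have "smult (1 + \<sigma> * s) (H (Suc n)) =
        monom 1 n + monom \<eta> (Suc n) + monom \<sigma> (Suc (Suc n)) + smult (\<theta> - s * \<eta>) (H n)
        - smult (\<sigma> * (\<tau> + s)) (pCons 0 (H n)) + smult ((s + \<tau>) * (1 + \<sigma> * s)) (qapp H (H n))"
    using eqs by (simp add: commutator_eqs_def)
  then show ?thesis unfolding split
    by (simp add: smult_add_right right_diff_distrib smult_diff_left algebra_simps)
qed

lemma commutator_denominator:
  fixes \<sigma> \<tau> s :: real
  assumes "1 + \<sigma> * s > 0"
  shows "(1 + \<sigma> * s) * (1 - (s + \<tau>) * (if n = 0 then 0 else \<sigma> / (1 + \<sigma> * s)))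
      = (if n = (0::nat) then 1 + \<sigma> * s else 1 - \<sigma> * \<tau>)"
proof -
  have "(1 + \<sigma> * s) * (1 - (s + \<tau>) * \<kappa>) = 1 + \<sigma> * s - (s + \<tau>) * ((1 + \<sigma> * s) * \<kappa>)" for \<kappa>
    by (simp add: algebra_simps)
  moreover have "(1 + \<sigma> * s) * (\<sigma> / (1 + \<sigma> * s)) = \<sigma>" using assms by simp
  ultimately have "(1 + \<sigma> * s) * (1 - (s + \<tau>) * (\<sigma> / (1 + \<sigma> * s))) = 1 + \<sigma> * s - (s + \<tau>) * \<sigma>"
    by metis
  also have "\<dots> = 1 - \<sigma> * \<tau>" by (simp add: algebra_simps)
  finally show ?thesis by (cases "n = 0") simp_all
qed

text \<open>Degree and top coefficient go through one induction, since the top coefficient of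
  \<open>H n\<close> determines the factor in front of \<open>H (Suc n)\<close>. That factor is
  nonzero because \<open>1 + \<sigma> * s > 0\<close> and
  \<open>\<sigma> * \<tau> < 1\<close>.\<close>

lemma commutator_degree:
  assumes eqs: "commutator_eqs \<eta> \<theta> \<sigma> \<tau> s H" and "0 \<le> \<sigma>" "0 \<le> s" "\<sigma> * \<tau> < 1"
  shows "degree (H n) \<le> Suc n"
    and "coeff (H n) (Suc n) = (if n = 0 then 0 else \<sigma> / (1 + \<sigma> * s))"
proof -
  have pos: "1 + \<sigma> * s > 0" using assms by (simp add: add_pos_nonneg)
  have "(\<forall>j\<le>n. degree (H j) \<le> Suc j) \<and>
      coeff (H n) (Suc n) = (if n = 0 then 0 else \<sigma> / (1 + \<sigma> * s))"
  proof (induction n)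
    case 0
    then show ?case using eqs by (simp add: commutator_eqs_def)
  next
    case (Suc n)
    let ?\<kappa> = "coeff (H n) (Suc n)"
    let ?d = "(1 + \<sigma> * s) * (1 - (s + \<tau>) * ?\<kappa>)"
    have \<kappa>: "?\<kappa> = (if n = 0 then 0 else \<sigma> / (1 + \<sigma> * s))" using Suc by blast
    have d: "?d \<noteq> 0" unfolding \<kappa> commutator_denominator[OF pos] using pos assms by auto
    have dn: "degree (H n) \<le> Suc n" using Suc by blast
    have dj: "degree (H j) \<le> Suc (Suc n)" if "j \<le> n" for j
      using Suc that by (meson Suc_le_mono le_SucI le_trans)
    note step = commutator_step[OF eqs dn]
    have "degree (smult ?d (H (Suc n))) \<le> Suc (Suc n)"
      unfolding step
      by (intro degree_add_le degree_diff_le degree_sum_le order.trans[OF degree_smult_le]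
            order.trans[OF degree_monom_le])
         (use dn dj in \<open>auto intro: order.trans[OF degree_pCons_le]\<close>)
    then have deg: "degree (H (Suc n)) \<le> Suc (Suc n)" using d by simp
    have z: "coeff (H n) (Suc (Suc n)) = 0" using dn by (intro coeff_eq_0) auto
    have zj: "coeff (H j) (Suc (Suc n)) = 0" if "j \<le> n" for j
      using Suc that by (intro coeff_eq_0) (metis le_imp_less_Suc le_trans Suc_le_mono)
    have "?d * coeff (H (Suc n)) (Suc (Suc n)) = coeff (smult ?d (H (Suc n))) (Suc (Suc n))"
      by simp
    also have "\<dots> = \<sigma> - \<sigma> * (\<tau> + s) * ?\<kappa>"
      unfolding step using z zj by (simp add: coeff_sum)
    \<comment> \<open>Since \<open>\<sigma> - \<sigma> (\<tau> + s) \<kappa> = \<sigma> (1 - (s +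
      \<tau>) \<kappa>)\<close>, the quotient by \<open>?d\<close> does not depend on
      \<open>\<kappa>\<close>.\<close>
    also have "\<dots> = ?d * (\<sigma> / (1 + \<sigma> * s))"
      using pos by (simp add: field_simps)
    finally have "coeff (H (Suc n)) (Suc (Suc n)) = \<sigma> / (1 + \<sigma> * s)"
      using d mult_left_cancel by blast
    then show ?case using Suc deg by (auto simp: le_Suc_eq)
  qed
  then show "degree (H n) \<le> Suc n"
    and "coeff (H n) (Suc n) = (if n = 0 then 0 else \<sigma> / (1 + \<sigma> * s))"
    by blast+
qed

text \<open>With the denominator known explicitly, each coefficient is a finite expression in
  earlier ones and in \<open>s\<close>. This yields both uniqueness of \<open>H\<close> and its
  continuity in \<open>s\<close>.\<close>

lemma commutator_rec:
  assumes eqs: "commutator_eqs \<eta> \<theta> \<sigma> \<tau> s H" and "0 \<le> \<sigma>" "0 \<le> s" "\<sigma> * \<tau> < 1"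
  shows "coeff (H (Suc n)) k =
       (coeff (monom 1 n + monom \<eta> (Suc n) + monom \<sigma> (Suc (Suc n))) k
        + (\<theta> - s * \<eta>) * coeff (H n) k - \<sigma> * (\<tau> + s) * (case k of 0 \<Rightarrow> 0 | Suc k \<Rightarrow> coeff (H n) k)
        + (s + \<tau>) * (1 + \<sigma> * s) * (\<Sum>j\<le>n. coeff (H n) j * coeff (H j) k))
       / (if n = 0 then 1 + \<sigma> * s else 1 - \<sigma> * \<tau>)"
proof -
  have pos: "1 + \<sigma> * s > 0" using assms by (simp add: add_pos_nonneg)
  let ?d = "if n = 0 then 1 + \<sigma> * s else 1 - \<sigma> * \<tau>"
  have d: "(1 + \<sigma> * s) * (1 - (s + \<tau>) * coeff (H n) (Suc n)) = ?d"
    unfolding commutator_degree(2)[OF assms] by (rule commutator_denominator[OF pos])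
  have "?d \<noteq> 0" using pos assms by auto
  have "?d * coeff (H (Suc n)) k = coeff (smult ?d (H (Suc n))) k" by simp
  also have "smult ?d (H (Suc n)) =
        monom 1 n + monom \<eta> (Suc n) + monom \<sigma> (Suc (Suc n)) + smult (\<theta> - s * \<eta>) (H n)
        - smult (\<sigma> * (\<tau> + s)) (pCons 0 (H n))
        + smult ((s + \<tau>) * (1 + \<sigma> * s)) (\<Sum>j\<le>n. smult (coeff (H n) j) (H j))"
    unfolding d[symmetric] by (rule commutator_step[OF eqs commutator_degree(1)[OF assms]])
  finally show ?thesis using \<open>?d \<noteq> 0\<close>
    by (cases k) (simp_all add: coeff_sum eq_divide_eq mult.commute del: coeff_monom)
qed

lemma commutator_unique:
  assumes "commutator_eqs \<eta> \<theta> \<sigma> \<tau> s H" "commutator_eqs \<eta> \<theta> \<sigma> \<tau> s H'"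
    and "0 \<le> \<sigma>" "0 \<le> s" "\<sigma> * \<tau> < 1"
  shows "H = H'"
proof
  fix n show "H n = H' n"
  proof (induction n rule: less_induct)
    case (less n)
    show ?case
    proof (cases n)
      case 0
      then show ?thesis using assms by (simp add: commutator_eqs_def)
    next
      case (Suc m)
      then have eq: "H j = H' j" if "j \<le> m" for j using less that by simp
      then have "(\<Sum>j\<le>m. coeff (H m) j * coeff (H j) k) = (\<Sum>j\<le>m. coeff (H' m) j * coeff (H' j) k)" for k
        by simp
      then show ?thesis unfolding Suc
        by (intro poly_eqI) (simp only: commutator_rec[OF assms(1,3-)] commutator_rec[OF assms(2-)] eq order.refl)
    qed
  qed
qed

lemma commutator_tendsto:
  assumes eqs: "\<And>s. 0 \<le> s \<Longrightarrow> commutator_eqs \<eta> \<theta> \<sigma> \<tau> s (H s)"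
    and "0 \<le> \<sigma>" "\<sigma> * \<tau> < 1" "0 \<le> t"
    and lim: "(f \<longlongrightarrow> t) F" and nonneg: "eventually (\<lambda>x. 0 \<le> f x) F"
  shows "((\<lambda>x. coeff (H (f x) n) k) \<longlongrightarrow> coeff (H t n) k) F"
proof (induction n arbitrary: k rule: less_induct)
  case (less n)
  show ?case
  proof (cases n)
    case 0
    have "eventually (\<lambda>x. coeff (H (f x) n) k = coeff (H t n) k) F"
      using nonneg by eventually_elim (use eqs assms 0 in \<open>auto simp: commutator_eqs_def\<close>)
    then show ?thesis by (rule tendsto_eventually)
  next
    case (Suc m)
    have IH: "((\<lambda>x. coeff (H (f x) j) i) \<longlongrightarrow> coeff (H t j) i) F" if "j \<le> m" for i j
      using less that Suc by simp
    have IH': "((\<lambda>x. case k of 0 \<Rightarrow> 0 | Suc k \<Rightarrow> coeff (H (f x) m) k)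
        \<longlongrightarrow> (case k of 0 \<Rightarrow> 0 | Suc k \<Rightarrow> coeff (H t m) k)) F"
      by (cases k) (simp_all add: IH)
    have "1 + \<sigma> * t > 0" using assms by (simp add: add_pos_nonneg)
    then have nz: "(if m = 0 then 1 + \<sigma> * t else 1 - \<sigma> * \<tau>) \<noteq> 0" using assms by auto
    have den: "((\<lambda>x. if m = 0 then 1 + \<sigma> * f x else 1 - \<sigma> * \<tau>)
        \<longlongrightarrow> (if m = 0 then 1 + \<sigma> * t else 1 - \<sigma> * \<tau>)) F"
      by (auto intro!: tendsto_eq_intros lim)
    have "((\<lambda>x. (coeff (monom 1 m + monom \<eta> (Suc m) + monom \<sigma> (Suc (Suc m))) k
        + (\<theta> - f x * \<eta>) * coeff (H (f x) m) k
        - \<sigma> * (\<tau> + f x) * (case k of 0 \<Rightarrow> 0 | Suc k \<Rightarrow> coeff (H (f x) m) k)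
        + (f x + \<tau>) * (1 + \<sigma> * f x) * (\<Sum>j\<le>m. coeff (H (f x) m) j * coeff (H (f x) j) k))
       / (if m = 0 then 1 + \<sigma> * f x else 1 - \<sigma> * \<tau>)) \<longlongrightarrow> coeff (H t (Suc m)) k) F"
      unfolding commutator_rec[OF eqs[OF \<open>0 \<le> t\<close>] \<open>0 \<le> \<sigma>\<close> \<open>0 \<le> t\<close> \<open>\<sigma> * \<tau> < 1\<close>]
      by (intro tendsto_divide tendsto_add tendsto_diff tendsto_mult tendsto_sum tendsto_const
            lim IH IH' den nz) auto
    moreover have "eventually (\<lambda>x. (coeff (monom 1 m + monom \<eta> (Suc m) + monom \<sigma> (Suc (Suc m))) k
        + (\<theta> - f x * \<eta>) * coeff (H (f x) m) k
        - \<sigma> * (\<tau> + f x) * (case k of 0 \<Rightarrow> 0 | Suc k \<Rightarrow> coeff (H (f x) m) k)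
        + (f x + \<tau>) * (1 + \<sigma> * f x) * (\<Sum>j\<le>m. coeff (H (f x) m) j * coeff (H (f x) j) k))
       / (if m = 0 then 1 + \<sigma> * f x else 1 - \<sigma> * \<tau>) = coeff (H (f x) (Suc m)) k) F"
      using nonneg
      by eventually_elim
         (rule commutator_rec[symmetric], use eqs assms in auto)
    ultimately show ?thesis unfolding Suc by (rule Lim_transform_eventually)
  qed
qed

section \<open>Bijectivity of maps that preserve degrees\<close>

locale exact_degree =
  fixes P :: qseq
  assumes nonzero: "P n \<noteq> 0" and degree_eq: "degree (P n) = n"
begin

text \<open>In the monomial basis the map is triangular with nonzero diagonal entries
  \<open>coeff (P n) n\<close>, which gives injectivity and, by elimination of leading terms,
  surjectivity.\<close>

lemma qapp_coeff_top: "degree p \<le> n \<Longrightarrow> coeff (qapp P p) n = coeff p n * coeff (P n) n"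
  by (subst qapp_altdef[of p n])
     (auto simp: coeff_sum degree_eq intro!: sum.remove[of "{..n}" n, THEN trans] sum.neutral coeff_eq_0)

lemma qapp_eq_0: "qapp P p = 0 \<Longrightarrow> p = 0"
  using qapp_coeff_top[of p "degree p"] nonzero[of "degree p"] degree_eq[of "degree p"]
  by (metis coeff_0 leading_coeff_0_iff mult_eq_0_iff order.refl)

lemma qapp_inj: "qapp P p = qapp P q \<Longrightarrow> p = q"
  using qapp_eq_0[of "p - q"] by (simp add: qapp_diff)

lemma qapp_surj: "\<exists>q. qapp P q = p"
proof (induction "degree p" arbitrary: p rule: less_induct)
  case less
  let ?n = "degree p"
  define r where "r = p - smult (coeff p ?n / coeff (P ?n) ?n) (P ?n)"
  have nz: "coeff (P ?n) ?n \<noteq> 0"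
    using nonzero[of ?n] degree_eq[of ?n] by (metis leading_coeff_0_iff)
  have c0: "coeff r ?n = 0" using nz by (simp add: r_def)
  have le: "degree r \<le> ?n" unfolding r_def
    by (intro degree_diff_le order.trans[OF degree_smult_le]) (auto simp: degree_eq)
  have "\<exists>q. qapp P q = r"
  proof (cases "?n = 0")
    case True
    then have "r = 0" using c0 le by (metis le_zero_eq leading_coeff_0_iff)
    then show ?thesis using qapp_0 by blast
  next
    case False
    then have "degree r < ?n" using c0 le
      by (metis le_neq_implies_less leading_coeff_0_iff degree_0)
    then show ?thesis using less by blast
  qed
  then obtain q where "qapp P q = r" by blast
  then have "qapp P (q + monom (coeff p ?n / coeff (P ?n) ?n) ?n) = p"
    by (simp add: qapp_add r_def)
  then show ?case by blast
qed

end

section \<open>Consequences of the harness axioms\<close>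

locale harness =
  fixes P :: "real \<Rightarrow> real \<Rightarrow> qseq" and X :: qseq and \<eta> \<theta> \<sigma> \<tau> :: real
  assumes process: "polynomial_process P"
    and martingale: "0 \<le> s \<Longrightarrow> s \<le> t \<Longrightarrow>
      qmul (P s t) (qsub (qmul qF qD) (qmul (qmul qF qF) (qmul qD qD)))
        = qsub (qmul qF qD) (qmul (qmul qF qF) (qmul qD qD))"
    and intertwining: "t \<ge> 0 \<Longrightarrow> qmul (P 0 t) qF = qmul (qadd qF (qscale t X)) (P 0 t)"
    and q_commutation: "qsub (qmul X qF) (qscale (- \<sigma> * \<tau>) (qmul qF X)) =
            qadd (qadd (qadd (qadd qE (qscale \<eta> qF)) (qscale \<theta> X))
                       (qscale \<sigma> (qmul qF qF))) (qscale \<tau> (qmul X X))"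
begin

lemma exact_degree: "0 \<le> s \<Longrightarrow> s \<le> t \<Longrightarrow> exact_degree (P s t)"
  using process by (auto simp: polynomial_process_def exact_degree_def)

lemma P_0: assumes "0 \<le> s" "s \<le> t" shows "P s t 0 = 1"
proof -
  have "qmul (P s t) (qsub qE (qmul qF qD)) 0 = qsub qE (qmul qF qD) 0"
    using process assms by (auto simp: polynomial_process_def)
  then show ?thesis by (simp add: qmul_apply qsub_def qE_def qD_def)
qed

text \<open>The element in \<open>martingale\<close> is the sequence
  \<open>(0, x, 0, 0, ...)\<close>, so only its component of index 1 carries information.\<close>

lemma P_1: assumes "0 \<le> s" "s \<le> t" shows "P s t (Suc 0) = monom 1 (Suc 0)"
proof -
  have "qmul (P s t) (qsub (qmul qF qD) (qmul (qmul qF qF) (qmul qD qD))) (Suc 0)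
      = qsub (qmul qF qD) (qmul (qmul qF qF) (qmul qD qD)) (Suc 0)"
    using martingale[OF assms] by metis
  moreover have "qsub (qmul qF qD) (qmul (qmul qF qF) (qmul qD qD)) (Suc 0) = monom 1 (Suc 0)"
    by (simp add: qmul_apply qsub_def qD_def qapp_qmul qapp_qF monom_Suc)
  ultimately show ?thesis by (simp add: qmul_apply)
qed

lemma P_comp: "0 \<le> s \<Longrightarrow> s \<le> t \<Longrightarrow> qapp (P 0 s) (qapp (P s t) p) = qapp (P 0 t) p"
proof -
  assume "0 \<le> s" "s \<le> t"
  then have "qmul (P 0 s) (P s t) = P 0 t"
    using process by (auto simp: polynomial_process_def)
  then show ?thesis by (metis qapp_qmul)
qed

lemma P_pCons:
  assumes "t \<ge> 0"
  shows "qapp (P 0 t) (pCons 0 p)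
        = pCons 0 (qapp (P 0 t) p) + smult t (qapp X (qapp (P 0 t) p))"
  using arg_cong[OF intertwining[OF assms], of "\<lambda>Q. qapp Q p"]
  by (simp only: qapp_qmul qapp_qadd qapp_qscale qapp_qF)

lemma X_pCons: "qapp X (pCons 0 p) = p + smult \<eta> (pCons 0 p) + smult \<theta> (qapp X p)
    + smult \<sigma> (pCons 0 (pCons 0 p)) + smult \<tau> (qapp X (qapp X p))
    - smult (\<sigma> * \<tau>) (pCons 0 (qapp X p))"
proof -
  have "qapp X (pCons 0 p) - smult (- \<sigma> * \<tau>) (pCons 0 (qapp X p))
    = p + smult \<eta> (pCons 0 p) + smult \<theta> (qapp X p)
      + smult \<sigma> (pCons 0 (pCons 0 p)) + smult \<tau> (qapp X (qapp X p))"
    using arg_cong[OF q_commutation, of "\<lambda>Q. qapp Q p"]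
    by (simp only: qapp_qmul qapp_qadd qapp_qsub qapp_qscale qapp_qF qapp_qE)
  then show ?thesis
    by (simp only: diff_eq_eq mult_minus_left smult_minus_left add_uminus_conv_diff)
qed

text \<open>Since \<open>P 0 1\<close> fixes both 1 and \<open>x\<close>, the case
  \<open>t = 1\<close>, \<open>p = 1\<close> of \<open>P_pCons\<close> reads
  \<open>x = x + X(1)\<close>.\<close>

lemma X_0: "X 0 = 0"
proof -
  have m: "monom 1 (Suc 0) = pCons 0 (1::real poly)" by (simp add: monom_Suc)
  have "qapp (P 0 1) (pCons 0 1) = pCons 0 1"
    using P_1[of 0 1] qapp_monom[of "P 0 1" 1 "Suc 0"] by (simp add: m)
  then show ?thesis using P_pCons[of 1 1] P_0[of 0 1] by simp
qed

text \<open>\<open>H s\<close> is the conjugate of \<open>X\<close> by \<open>P 0 s\<close>; the choice is unique since \<open>qapp (P 0 s)\<close> is bijective.\<close>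
definition H :: "real \<Rightarrow> qseq" where
  "H s n = (SOME q. qapp (P 0 s) q = qapp X (P 0 s n))"

lemma P_H:
  assumes "s \<ge> 0"
  shows "qapp (P 0 s) (qapp (H s) p) = qapp X (qapp (P 0 s) p)"
proof -
  interpret exact_degree "P 0 s" using exact_degree assms by simp
  have "qapp (P 0 s) (H s n) = qapp X (P 0 s n)" for n
    unfolding H_def by (rule someI_ex[OF qapp_surj])
  then have "qmul (P 0 s) (H s) = qmul X (P 0 s)" by (auto simp: qmul_apply)
  then show ?thesis by (metis qapp_qmul)
qed

text \<open>After applying the injective map \<open>P 0 s\<close>, \<open>H s\<close> becomes
  \<open>X\<close> and multiplication by \<open>x\<close> becomes \<open>F + s X\<close>; the claim
  is then a rearrangement of the relation between \<open>X\<close> and \<open>F\<close>.\<close>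

lemma commutator_eqs_H:
  assumes s: "s \<ge> 0"
  shows "commutator_eqs \<eta> \<theta> \<sigma> \<tau> s (H s)"
  unfolding commutator_eqs_def
proof safe
  interpret exact_degree "P 0 s" using exact_degree assms by simp
  have "qapp (P 0 s) (H s 0) = qapp (P 0 s) 0"
    using P_H[OF s, of "monom 1 0"] X_0 P_0[of 0 s] s by simp
  then show "H s 0 = 0" by (rule qapp_inj)
  fix n
  define r where "r = P 0 s n"
  note p = P_pCons[OF s] P_H[OF s]
  have P_n: "qapp (P 0 s) (monom 1 n) = r" by (simp add: r_def)
  have mS: "monom c (Suc n) = smult c (pCons 0 (monom 1 n))"
    "monom c (Suc (Suc n)) = smult c (pCons 0 (pCons 0 (monom 1 n)))" for c :: real
    by (simp_all add: monom_Suc smult_monom)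
  have H_Suc: "H s (Suc n) = qapp (H s) (pCons 0 (monom 1 n))"
    using qapp_monom[of "H s" 1 "Suc n"] by (simp add: monom_Suc)
  have H_n: "H s n = qapp (H s) (monom 1 n)" by simp
  have X_r: "coeff (qapp X (pCons 0 r)) k
        = coeff r k + \<eta> * coeff (pCons 0 r) k + \<theta> * coeff (qapp X r) k
          + \<sigma> * coeff (pCons 0 (pCons 0 r)) k + \<tau> * coeff (qapp X (qapp X r)) k
          - \<sigma> * \<tau> * coeff (pCons 0 (qapp X r)) k" for k
    using arg_cong[OF X_pCons[of r], of "\<lambda>q. coeff q k"]
    by (simp only: coeff_add coeff_diff coeff_smult)
  have pC: "pCons 0 (pCons 0 r + smult s q) = pCons 0 (pCons 0 r) + smult s (pCons 0 q)" for q
    by simp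
    \<comment> \<open>The names list the operators applied to \<open>r\<close>: \<open>xf\<close>
      stands for a coefficient of \<open>X F r\<close>, \<open>fxr\<close> for one of
      \<open>F X r\<close>, and so on; \<open>r'\<close> is a coefficient of \<open>r\<close>
      itself.\<close>
    have ring_id: "xf = r' + \<eta> * fr + \<theta> * xr + \<sigma> * ffr + \<tau> * xxr - \<sigma> * \<tau> * fxr \<Longrightarrow>
        (1 + \<sigma> * s) * (xf + s * xxr) = r' + \<eta> * (fr + s * xr)
          + \<sigma> * ((ffr + s * fxr) + s * (xf + s * xxr)) + (\<theta> - s * \<eta>) * xr
          - \<sigma> * (\<tau> + s) * (fxr + s * xxr) + (s + \<tau>) * (1 + \<sigma> * s) * xxr"
      for xf r' fr xr ffr xxr fxr :: real
      by (simp add: algebra_simps)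
  show "smult (1 + \<sigma> * s) (H s (Suc n)) =
        monom 1 n + monom \<eta> (Suc n) + monom \<sigma> (Suc (Suc n)) + smult (\<theta> - s * \<eta>) (H s n)
        - smult (\<sigma> * (\<tau> + s)) (pCons 0 (H s n))
        + smult ((s + \<tau>) * (1 + \<sigma> * s)) (qapp (H s) (H s n))"
    unfolding H_Suc H_n mS
    by (rule qapp_inj, rule poly_eqI,
        unfold qapp_add qapp_diff qapp_smult p P_n pC coeff_add coeff_smult coeff_diff)
       (rule ring_id[OF X_r])
qed

text \<open>The intertwining relation started at time \<open>s\<close> instead of 0. Under
  \<open>P 0 s\<close> the term \<open>t X\<close> splits into \<open>s X\<close>, coming from
  multiplication by \<open>x\<close>, and \<open>(t - s) X\<close>, coming from
  \<open>H s\<close>.\<close>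

lemma P_Suc:
  assumes "0 \<le> s" "s \<le> t"
  shows "P s t (Suc n) = pCons 0 (P s t n) + smult (t - s) (qapp (H s) (P s t n))"
proof -
  interpret exact_degree "P 0 s" using exact_degree assms by simp
  let ?r = "qapp (P 0 s) (P s t n)"
  have t: "t \<ge> 0" using assms by simp
  have r: "?r = P 0 t n" using P_comp[OF assms, of "monom 1 n"] by simp
  have "qapp (P 0 s) (P s t (Suc n)) = qapp (P 0 t) (pCons 0 (monom 1 n))"
    using P_comp[OF assms, of "monom 1 (Suc n)"]
    by (simp only: qapp_monom smult_1_left) (simp flip: monom_Suc)
  also have "\<dots> = pCons 0 ?r + smult t (qapp X ?r)"
    unfolding P_pCons[OF t] r by simp
  also have "\<dots> = qapp (P 0 s) (pCons 0 (P s t n) + smult (t - s) (qapp (H s) (P s t n)))"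
    unfolding qapp_add qapp_smult P_pCons[OF \<open>0 \<le> s\<close>] P_H[OF \<open>0 \<le> s\<close>]
    by (simp add: smult_diff_left)
  finally show ?thesis by (rule qapp_inj)
qed

end

text \<open>By \<open>P_Suc\<close> the difference quotient at \<open>x ^ Suc n\<close> is
  \<open>x\<close> times the one at \<open>x ^ n\<close> plus \<open>H (t - h)\<close> applied to
  \<open>P (t - h) t n\<close>. The latter tends to \<open>H t n\<close> by continuity of
  \<open>H\<close>, provided \<open>P (t - h) t n\<close> tends to \<open>x ^ n\<close>; hence both
  limits are proved together.\<close>

lemma (in harness) generator_limit:
  assumes par: "0 \<le> \<sigma>" "\<sigma> * \<tau> < 1" "t > 0"
    and A_0: "A 0 = 0" and A_Suc: "\<And>n. A (Suc n) = pCons 0 (A n) + H t n"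
  shows "generator_is P t p (qapp A p)"
proof -
  have lim_t: "((\<lambda>h. t - h) \<longlongrightarrow> t) (at_right 0)"
    by (auto intro!: tendsto_eq_intros)
  have ev: "eventually (\<lambda>h. 0 < h \<and> 0 \<le> t - h) (at_right 0)"
    using eventually_at_right_less[of "0::real"] eventually_at_right[of 0 t] par
    by (auto elim!: eventually_elim2 simp: eventually_at_right_field intro!: exI[of _ t])
  have H_lim: "((\<lambda>h. coeff (H (t - h) j) k) \<longlongrightarrow> coeff (H t j) k) (at_right 0)" for j k
    by (rule commutator_tendsto[OF commutator_eqs_H _ _ _ lim_t])
       (use par ev in \<open>auto elim: eventually_mono\<close>)
  have deg: "degree (P (t - h) t n) = n" if "0 < h" "0 \<le> t - h" for h n
    using exact_degree[of "t - h" t] that by (simp add: exact_degree_def)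
  have "((\<lambda>h. coeff (P (t - h) t n) k) \<longlongrightarrow> coeff (monom 1 n) k) (at_right 0) \<and>
        ((\<lambda>h. coeff (P (t - h) t n - monom 1 n) k / h) \<longlongrightarrow> coeff (A n) k) (at_right 0)" for n k
  proof (induction n arbitrary: k)
    case 0
    have "eventually (\<lambda>h. P (t - h) t 0 = 1) (at_right 0)"
      using ev by eventually_elim (use P_0 in auto)
    then have "eventually (\<lambda>h. coeff (P (t - h) t 0) k = coeff (monom 1 0) k) (at_right 0)"
      "eventually (\<lambda>h. coeff (P (t - h) t 0 - monom 1 0) k / h = coeff (A 0) k) (at_right 0)"
      by (eventually_elim, simp add: A_0)+
    then show ?case by (auto intro: tendsto_eventually)
  next
    case (Suc n)
    \<comment> \<open>The degree of \<open>P (t - h) t n\<close> is \<open>n\<close> for every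
      admissible \<open>h\<close>, so the number of summands is fixed and limits can be taken
      termwise.\<close>
    let ?HP = "\<lambda>h k. \<Sum>j\<le>n. coeff (P (t - h) t n) j * coeff (H (t - h) j) k"
    let ?sh = "\<lambda>p. case k of 0 \<Rightarrow> 0 | Suc k \<Rightarrow> coeff p k"
    have HP: "coeff (qapp (H (t - h)) (P (t - h) t n)) k = ?HP h k" if "0 < h" "0 \<le> t - h" for h
      using deg[OF that, of n] by (simp add: qapp_def coeff_sum)
    have "((\<lambda>h. ?HP h k) \<longlongrightarrow> (\<Sum>j\<le>n. coeff (monom 1 n) j * coeff (H t j) k)) (at_right 0)"
      by (intro tendsto_sum tendsto_mult H_lim) (use Suc in blast)
    also have "(\<Sum>j\<le>n. coeff (monom 1 n) j * coeff (H t j) k) = coeff (H t n) k"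
      by (simp add: if_distrib[of "\<lambda>c. c * _"] cong: if_cong)
    finally have HPlim: "((\<lambda>h. ?HP h k) \<longlongrightarrow> coeff (H t n) k) (at_right 0)" .
    have P: "coeff (P (t - h) t (Suc n)) k = ?sh (P (t - h) t n) + h * ?HP h k"
      if "0 < h" "0 \<le> t - h" for h
      using P_Suc[of "t - h" t n] that HP[OF that] by (simp add: coeff_pCons)
    have id_lim: "((\<lambda>h::real. h) \<longlongrightarrow> 0) (at_right 0)" by (rule tendsto_ident_at)
    have "((\<lambda>h. ?sh (P (t - h) t n) + h * ?HP h k)
        \<longlongrightarrow> ?sh (monom 1 n) + 0 * coeff (H t n) k) (at_right 0)"
      by (intro tendsto_add tendsto_mult HPlim id_lim) (cases k; use Suc in auto)
    then have "((\<lambda>h. coeff (P (t - h) t (Suc n)) k) \<longlongrightarrow> coeff (monom 1 (Suc n)) k) (at_right 0)"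
      by (rule Lim_transform_eventually[THEN tendsto_eq_rhs])
         (use ev in eventually_elim, use P in \<open>auto split: nat.splits\<close>)
    moreover
    have "((\<lambda>h. ?sh (P (t - h) t n - monom 1 n) / h + ?HP h k)
        \<longlongrightarrow> ?sh (A n) + coeff (H t n) k) (at_right 0)"
      by (intro tendsto_add HPlim) (cases k; use Suc in auto)
    moreover have "eventually (\<lambda>h. ?sh (P (t - h) t n - monom 1 n) / h + ?HP h k
        = coeff (P (t - h) t (Suc n) - monom 1 (Suc n)) k / h) (at_right 0)"
      using ev
    proof eventually_elim
      case (elim h)
      then have "coeff (P (t - h) t (Suc n) - monom 1 (Suc n)) k
          = ?sh (P (t - h) t n - monom 1 n) + h * ?HP h k"
        using P[of h] by (auto split: nat.splits)
      then show ?case using elim by (simp add: add_divide_distrib)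
    qed
    ultimately show ?case
      by (auto simp: A_Suc coeff_pCons dest: Lim_transform_eventually)
  qed
  then have lim: "((\<lambda>h. coeff (P (t - h) t n - monom 1 n) k / h) \<longlongrightarrow> coeff (A n) k) (at_right 0)" for n k
    by blast
  show ?thesis unfolding generator_is_def
  proof
    fix k
    have "((\<lambda>h. \<Sum>j\<le>degree p. coeff p j * (coeff (P (t - h) t j - monom 1 j) k / h))
        \<longlongrightarrow> (\<Sum>j\<le>degree p. coeff p j * coeff (A j) k)) (at_right 0)"
      by (intro tendsto_sum tendsto_mult tendsto_const lim)
    moreover have "(\<Sum>j\<le>degree p. coeff p j * (coeff (P (t - h) t j - monom 1 j) k / h))
        = coeff (qapp (P (t - h) t) p - p) k / h" for h
    proof -
      have "qapp (P (t - h) t) p - p = (\<Sum>j\<le>degree p. smult (coeff p j) (P (t - h) t j - monom 1 j))"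
        by (simp add: smult_diff_right sum_subtractf qapp_def smult_monom poly_as_sum_of_monoms)
      then show ?thesis by (simp add: coeff_sum sum_divide_distrib)
    qed
    ultimately show "((\<lambda>h. coeff (qapp (P (t - h) t) p - p) k / h) \<longlongrightarrow> coeff (qapp A p) k) (at_right 0)"
      by (simp add: qapp_def coeff_sum)
  qed
qed

section \<open>The generator in terms of moments\<close>

lemma qapp_pCons: "qapp P (pCons a p) = smult a (P 0) + qapp (\<lambda>j. P (Suc j)) p"
proof -
  have "degree (pCons a p) \<le> Suc (degree p)" by (simp add: degree_pCons_le)
  then have "qapp P (pCons a p) = (\<Sum>j\<le>Suc (degree p). smult (coeff (pCons a p) j) (P j))"
    by (rule qapp_altdef)
  then show ?thesis
    by (simp add: sum.atMost_Suc_shift qapp_def del: sum.atMost_Suc)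
qed

text \<open>\<open>dquot m n\<close> is \<open>\<Sum>j<n. m (n - 1 - j) x ^ j\<close>, the image of \<open>(y ^ n - x ^ n) / (y - x)\<close>
  under the functional with moments \<open>m\<close> in the variable \<open>y\<close>.\<close>
primrec dquot :: "(nat \<Rightarrow> real) \<Rightarrow> nat \<Rightarrow> real poly" where
  "dquot m 0 = 0"
| "dquot m (Suc n) = pCons (m n) (dquot m n)"

lemma degree_dquot: "degree (dquot m n) \<le> n"
  by (induction n) (auto intro: order.trans[OF degree_pCons_le])

lemma coeff_dquot: "coeff (dquot m n) j = (if j < n then m (n - 1 - j) else 0)"
  by (induction n arbitrary: j) (auto simp: coeff_pCons split: nat.splits)

text \<open>The coefficients of \<open>dquot m n\<close> make this a convolution; the factor
  \<open>fps_X\<close> accounts for the shift in \<open>n - 1 - j\<close>.\<close>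

lemma qapp_dquot:
  "poly (qapp P (dquot m n)) x = fps_nth (fps_X * Abs_fps m * Abs_fps (\<lambda>j. poly (P j) x)) n"
proof -
  have "poly (qapp P (dquot m n)) x = (\<Sum>j\<le>n. (if j < n then m (n - 1 - j) else 0) * poly (P j) x)"
    using degree_dquot[of m n] by (simp add: qapp_altdef[of _ n] poly_sum coeff_dquot)
  also have "\<dots> = (\<Sum>j<n. m (n - 1 - j) * poly (P j) x)"
    by (rule sum.mono_neutral_cong_right) auto
  also have "\<dots> = fps_nth (fps_X * (Abs_fps m * Abs_fps (\<lambda>j. poly (P j) x))) n"
  proof (cases n)
    case (Suc k)
    have "(\<Sum>j\<le>k. m (k - j) * poly (P j) x) = (\<Sum>j\<le>k. m j * poly (P (k - j)) x)"
      by (rule sum.reindex_bij_witness[of _ "\<lambda>j. k - j" "\<lambda>j. k - j"]) auto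
    then show ?thesis unfolding Suc fps_X_mult_nth
      by (simp add: fps_mult_nth lessThan_Suc_atMost atLeast0AtMost)
  qed simp
  finally show ?thesis by (simp only: mult.assoc)
qed

text \<open>At a fixed \<open>x\<close>, the equations for all \<open>n\<close> together are one
  identity of power series in \<open>z\<close>. Here \<open>dquot\<close> has generating series
  \<open>z M / (1 - x z)\<close>, and clearing the denominator leaves the quadratic equation for
  \<open>M\<close>.\<close>

lemma commutator_eqs_dquot:
  fixes m :: "nat \<Rightarrow> real"
  defines "M \<equiv> Abs_fps m"
  assumes eq: "(fps_X * fps_X + fps_const \<eta> * fps_X + fps_const \<sigma>) * (fps_const t + fps_const \<tau>) * (M * M)
      + ((fps_const \<theta> - fps_const t * fps_const \<eta>) * fps_X - fps_const t * fps_const \<sigma>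
         - fps_const t * fps_const \<sigma> - fps_const \<sigma> * fps_const \<tau> - 1) * M
      + fps_const t * fps_const \<sigma> + 1 = 0"
    and m_0: "m 0 = 1" and nz: "1 + \<sigma> * t \<noteq> 0"
  shows "commutator_eqs \<eta> \<theta> \<sigma> \<tau> t (\<lambda>n. smult (1 / (1 + \<sigma> * t)) [:1, \<eta>, \<sigma>:] * dquot m n)"
proof -
  define C where "C = smult (1 / (1 + \<sigma> * t)) [:1, \<eta>, \<sigma>:]"
  define H where "H = (\<lambda>n. C * dquot m n)"
  have "smult (1 + \<sigma> * t) (H (Suc n)) =
        monom 1 n + monom \<eta> (Suc n) + monom \<sigma> (Suc (Suc n)) + smult (\<theta> - t * \<eta>) (H n)
        - smult (\<sigma> * (\<tau> + t)) (pCons 0 (H n)) + smult ((t + \<tau>) * (1 + \<sigma> * t)) (qapp H (H n))"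
    (is "?l = ?r") for n
  proof (subst poly_eq_poly_eq_iff[symmetric], rule ext)
    fix x
    define g where "g n = poly (dquot m n) x" for n
    define c where "c = fps_const x"
    define G where "G = Abs_fps g"
    \<comment> \<open>The factor \<open>1 + \<eta> x + \<sigma> x^2\<close> in \<open>H n\<close>
      shifts indices when \<open>H\<close> is applied to it, so the composition involves the series
      of \<open>g\<close> shifted by 0, 1 and 2.\<close>
    define G1 where "G1 = Abs_fps (\<lambda>n. g (Suc n))"
    define G2 where "G2 = Abs_fps (\<lambda>n. g (Suc (Suc n)))"
    define E where "E = Abs_fps (\<lambda>n. x ^ n)"
    define Cx where "Cx = poly C x"
    have g_Suc: "g (Suc n) = m n + x * g n" for n by (simp add: g_def)
    have g_0: "g 0 = 0" by (simp add: g_def)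
    have nths: "fps_nth G n = g n" "fps_nth G1 n = g (Suc n)" "fps_nth E n = x ^ n" for n
      by (simp_all add: G_def G1_def E_def)
    have G1: "G1 = M + c * G"
      by (rule fps_ext) (simp add: G1_def M_def c_def G_def g_Suc)
    have G: "G = fps_X * G1"
    proof (rule fps_ext)
      fix n show "fps_nth G n = fps_nth (fps_X * G1) n"
        by (cases n) (simp_all add: G_def G1_def g_0)
    qed
    have G2: "fps_X * G2 = G1 - 1"
    proof (rule fps_ext)
      fix n show "fps_nth (fps_X * G2) n = fps_nth (G1 - 1) n"
        by (cases n) (simp_all add: G2_def G1_def g_0 g_Suc m_0)
    qed
    have E: "(1 - c * fps_X) * E = 1"
    proof (rule fps_ext)
      fix n show "fps_nth ((1 - c * fps_X) * E) n = fps_nth 1 n"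
        by (cases n) (simp_all add: c_def E_def left_diff_distrib mult.assoc)
    qed
    have dG1: "(1 - c * fps_X) * G1 = M"
    proof -
      have "(1 - c * fps_X) * G1 = G1 - c * (fps_X * G1)" by (simp add: left_diff_distrib mult.assoc)
      also have "\<dots> = M" unfolding G[symmetric] by (simp add: G1)
      finally show ?thesis .
    qed
    \<comment> \<open>Multiplication by \<open>d = 1 - c X\<close> replaces \<open>E\<close> by 1
      and \<open>G1\<close> by \<open>M\<close>; the difference of the two sides is then the
      left-hand side of the equation for \<open>M\<close>. The factor \<open>d\<close> is cancelled
      afterwards.\<close>
    have ring_id: "d * (k * G1) = d * (k * E + h * (X * G1) - (s * (ta + tt)) * c * (X * G1)
          + (tt + ta) * (X * M * (X * G1) + et * (X * M * G1) + s * (M * (G1 - 1))))"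
      if "d = 1 - c * X" "d * E = 1" "d * G1 = M" "k = 1 + s * tt" "h = th - tt * et"
        "(X * X + et * X + s) * (tt + ta) * (M * M)
          + ((th - tt * et) * X - tt * s - tt * s - s * ta - 1) * M + tt * s + 1 = 0"
      for d k E h X s ta tt et th G1 :: "real fps"
    proof -
      have "d * (k * E + h * (X * G1) - (s * (ta + tt)) * c * (X * G1)
          + (tt + ta) * (X * M * (X * G1) + et * (X * M * G1) + s * (M * (G1 - 1))))
        = k * (d * E) + h * (X * (d * G1)) - (s * (ta + tt)) * c * (X * (d * G1))
          + (tt + ta) * (X * M * (X * (d * G1)) + et * (X * M * (d * G1)) + s * (M * (d * G1 - d)))"
        by (simp only: algebra_simps mult_1_left)
      also have "\<dots> = k * (d * G1) + ((X * X + et * X + s) * (tt + ta) * (M * M)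
          + ((th - tt * et) * X - tt * s - tt * s - s * ta - 1) * M + tt * s + 1)"
        unfolding that(2,3) unfolding that(1,4,5) by (simp add: algebra_simps)
      also have "\<dots> = d * (k * G1)" unfolding that(6) by (simp add: mult.left_commute)
      finally show ?thesis ..
    qed
    have "(1 - c * fps_X) * (fps_const (1 + \<sigma> * t) * G1) = (1 - c * fps_X) *
        (fps_const (1 + \<sigma> * t) * E + fps_const (\<theta> - t * \<eta>) * (fps_X * G1)
          - (fps_const \<sigma> * (fps_const \<tau> + fps_const t)) * c * (fps_X * G1)
          + (fps_const t + fps_const \<tau>) * (fps_X * M * (fps_X * G1)
             + fps_const \<eta> * (fps_X * M * G1) + fps_const \<sigma> * (M * (G1 - 1))))"
      by (rule ring_id[OF refl E dG1 _ _ eq]) simp_all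
    moreover have "1 - c * fps_X \<noteq> 0" using E by auto
    ultimately have "fps_const (1 + \<sigma> * t) * G1 =
        fps_const (1 + \<sigma> * t) * E + fps_const (\<theta> - t * \<eta>) * G
          - fps_const (\<sigma> * (\<tau> + t) * x) * G
          + fps_const (t + \<tau>) * (fps_X * M * G
             + fps_const \<eta> * (fps_X * M * G1) + fps_const \<sigma> * (fps_X * M * G2))"
      unfolding mult_left_cancel using G2 G by (simp add: c_def mult_ac flip: fps_const_mult fps_const_add)
    from arg_cong[OF this, of "\<lambda>F. fps_nth F n"]
    have key: "(1 + \<sigma> * t) * g (Suc n) = (1 + \<sigma> * t) * x ^ n + (\<theta> - t * \<eta>) * g n
        - \<sigma> * (\<tau> + t) * x * g n
        + (t + \<tau>) * (fps_nth (fps_X * M * G) n + \<eta> * fps_nth (fps_X * M * G1) n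
          + \<sigma> * fps_nth (fps_X * M * G2) n)"
      by (simp only: fps_add_nth fps_sub_nth fps_mult_left_const_nth nths)
    have C_x: "(1 + \<sigma> * t) * Cx = 1 + \<eta> * x + \<sigma> * x\<^sup>2"
    proof -
      have "poly [:1, \<eta>, \<sigma>:] x = 1 + \<eta> * x + \<sigma> * x\<^sup>2"
        by (simp add: power2_eq_square algebra_simps)
      then have "Cx = 1 / (1 + \<sigma> * t) * (1 + \<eta> * x + \<sigma> * x\<^sup>2)"
        by (simp only: Cx_def C_def poly_smult)
      then show ?thesis using nz by simp
    qed
    have lin: "fps_nth (fps_X * M * Abs_fps (\<lambda>j. Cx * f j)) n = Cx * fps_nth (fps_X * M * Abs_fps f) n" for f
    proof -
      have "Abs_fps (\<lambda>j. Cx * f j) = fps_const Cx * Abs_fps f" by (rule fps_ext) simp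
      then show ?thesis by (simp only: mult.left_commute[of _ "fps_const Cx"] fps_mult_left_const_nth)
    qed
    have H_n: "H n = smult (1 / (1 + \<sigma> * t)) (dquot m n + smult \<eta> (pCons 0 (dquot m n))
        + smult \<sigma> (pCons 0 (pCons 0 (dquot m n))))"
      by (simp add: H_def C_def smult_add_right algebra_simps)
    have "poly (qapp H (H n)) x = 1 / (1 + \<sigma> * t) * (Cx * (fps_nth (fps_X * M * G) n
        + \<eta> * fps_nth (fps_X * M * G1) n + \<sigma> * fps_nth (fps_X * M * G2) n))"
      unfolding H_n qapp_smult qapp_add qapp_pCons poly_smult poly_add qapp_dquot
      by (simp only: H_def poly_mult Cx_def[symmetric] g_def[symmetric] M_def[symmetric] lin
            G_def[symmetric] G1_def[symmetric] G2_def[symmetric])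
         (simp add: algebra_simps)
    then have HH: "(1 + \<sigma> * t) * poly (qapp H (H n)) x = Cx * (fps_nth (fps_X * M * G) n
        + \<eta> * fps_nth (fps_X * M * G1) n + \<sigma> * fps_nth (fps_X * M * G2) n)"
      using nz by simp
    have H_x: "poly (H n) x = Cx * g n" for n by (simp add: H_def Cx_def g_def)
    have "poly ?r x = (1 + \<eta> * x + \<sigma> * x\<^sup>2) * x ^ n + (\<theta> - t * \<eta>) * (Cx * g n)
        - \<sigma> * (\<tau> + t) * (x * (Cx * g n)) + (t + \<tau>) * ((1 + \<sigma> * t) * poly (qapp H (H n)) x)"
      by (simp add: poly_monom H_x power2_eq_square algebra_simps)
    also have "\<dots> = Cx * ((1 + \<sigma> * t) * g (Suc n))"
      unfolding HH key C_x[symmetric] by (simp add: algebra_simps)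
    also have "\<dots> = poly ?l x" by (simp add: H_x)
    finally show "poly ?l x = poly ?r x" ..
  qed
  then show ?thesis unfolding commutator_eqs_def H_def C_def by simp
qed

section \<open>Divided differences and their integrals\<close>

lemma pderiv_sum: "pderiv (sum f A) = (\<Sum>x\<in>A. pderiv (f x))"
  by (induction A rule: infinite_finite_induct) (auto simp: pderiv_add)

text \<open>Shows that the divided difference is a polynomial in \<open>x\<close> for each
  \<open>y\<close>, including the diagonal, so that \<open>deriv\<close> can be computed without a
  case distinction.\<close>

lemma divdiff_altdef: "divdiff p x y = poly (qapp (dquot (\<lambda>k. y ^ k)) p) x"
proof -
  have diff: "(y - x) * poly (dquot (\<lambda>k. y ^ k) n) x = y ^ n - x ^ n" for n
  proof (induction n)
    case (Suc n)
    have "(y - x) * poly (dquot (\<lambda>k. y ^ k) (Suc n)) x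
        = (y - x) * y ^ n + x * ((y - x) * poly (dquot (\<lambda>k. y ^ k) n) x)"
      by (simp add: algebra_simps)
    then show ?case unfolding Suc by (simp add: algebra_simps)
  qed simp
  have diag: "poly (dquot (\<lambda>k. x ^ k) n) x = of_nat n * x ^ (n - 1)" for n
  proof (induction n)
    case (Suc n)
    then show ?case by (cases n) (simp_all add: algebra_simps)
  qed simp
  show ?thesis
  proof (cases "y = x")
    case True
    have "poly (pderiv p) x = (\<Sum>n\<le>degree p. coeff p n * (of_nat n * x ^ (n - 1)))"
    proof -
      have "p = (\<Sum>n\<le>degree p. monom (coeff p n) n)" by (simp add: poly_as_sum_of_monoms)
      then have "pderiv p = (\<Sum>n\<le>degree p. pderiv (monom (coeff p n) n))"
        by (metis (no_types) pderiv_sum)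
      then show ?thesis by (simp add: poly_sum pderiv_monom poly_monom mult_ac)
    qed
    then show ?thesis using True by (simp add: divdiff_def qapp_def poly_sum diag)
  next
    case False
    have "(y - x) * poly (qapp (dquot (\<lambda>k. y ^ k)) p) x
        = (\<Sum>n\<le>degree p. coeff p n * ((y - x) * poly (dquot (\<lambda>k. y ^ k) n) x))"
      by (simp add: qapp_def poly_sum sum_distrib_left mult.left_commute)
    also have "\<dots> = poly p y - poly p x"
      unfolding diff by (simp add: poly_altdef right_diff_distrib sum_subtractf)
    finally show ?thesis using False by (simp add: divdiff_def field_simps)
  qed
qed

text \<open>The polynomial \<open>dquot m n\<close> is linear in \<open>m\<close>, so integrating it
  over \<open>y\<close> replaces the powers of \<open>y\<close> by the moments, before or after
  differentiation in \<open>x\<close>.\<close>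

lemma integral_pderiv_dquot:
  assumes int: "\<And>k. integrable \<nu> (\<lambda>y. y ^ k)"
  defines "m \<equiv> \<lambda>k. \<integral>y. y ^ k \<partial>\<nu>"
  shows "has_bochner_integral \<nu> (\<lambda>y. poly (pderiv (dquot (\<lambda>k. y ^ k) n)) x) (poly (pderiv (dquot m n)) x)"
proof -
  have m: "has_bochner_integral \<nu> (\<lambda>y. y ^ k) (m k)" for k
    unfolding m_def by (rule has_bochner_integral_integrable[OF int])
  have dq: "has_bochner_integral \<nu> (\<lambda>y. poly (dquot (\<lambda>k. y ^ k) n) x) (poly (dquot m n) x)" for n
    by (induction n) (auto intro!: has_bochner_integral_add has_bochner_integral_mult_right m)
  show ?thesis
    by (induction n)
       (auto simp: pderiv_pCons intro!: has_bochner_integral_add has_bochner_integral_mult_right dq)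
qed

lemma integral_deriv_divdiff:
  assumes int: "\<And>k. integrable \<nu> (\<lambda>y. y ^ k)"
  defines "m \<equiv> \<lambda>k. \<integral>y. y ^ k \<partial>\<nu>"
  shows "(\<integral>y. deriv (\<lambda>x'. divdiff p x' y) x \<partial>\<nu>) = poly (pderiv (qapp (dquot m) p)) x"
proof -
  have deriv: "deriv (\<lambda>x'. divdiff p x' y) x = poly (pderiv (qapp (dquot (\<lambda>k. y ^ k)) p)) x" for y
    unfolding divdiff_altdef by (rule DERIV_imp_deriv) (rule poly_DERIV)
  have lin: "poly (pderiv (qapp P p)) x = (\<Sum>n\<le>degree p. coeff p n * poly (pderiv (P n)) x)" for P
    by (simp add: qapp_def pderiv_sum pderiv_smult poly_sum)
  have "has_bochner_integral \<nu> (\<lambda>y. \<Sum>n\<le>degree p. coeff p n * poly (pderiv (dquot (\<lambda>k. y ^ k) n)) x)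
      (\<Sum>n\<le>degree p. coeff p n * poly (pderiv (dquot m n)) x)"
    unfolding m_def
    by (intro has_bochner_integral_sum has_bochner_integral_mult_right integral_pderiv_dquot int)
  then show ?thesis unfolding deriv lin by (rule has_bochner_integral_integral_eq)
qed

section \<open>The main theorem\<close>

text \<open>The left-hand side is the equation of \<open>jacobi_mgf\<close> up to the factor
  \<open>g / D\<close>. Comparing the coefficients of \<open>z * \<phi>\<close> forces the value of
  \<open>A\<close>; the two sides then differ by a multiple of the defining relation of
  \<open>\<beta>\<close>.\<close>

lemma generating_function_algebra:
  fixes \<eta> \<theta> \<sigma> \<tau> t \<alpha> \<beta> D A z \<phi> :: real
  assumes "D = 1 - \<sigma> * \<tau>" "D * \<alpha> = \<eta> + \<theta> * \<sigma>" "D * \<beta> = \<eta> * \<tau> + \<theta>"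
    and "A = 2 * (1 + t * \<sigma>) * \<beta> - \<theta> + t * \<eta>" and "D \<noteq> 0"
  shows "(1 + t * \<sigma>) * ((1 - \<beta> * z) * \<phi> - 1)\<^sup>2 - (D - A * z) * \<phi> * ((1 - \<beta> * z) * \<phi> - 1)
      + (t + \<tau>) * (1 + \<alpha> * \<beta>) * z\<^sup>2 * \<phi>\<^sup>2
    = (z\<^sup>2 + \<eta> * z + \<sigma>) * (t + \<tau>) * \<phi>\<^sup>2
        + ((\<theta> - t * \<eta>) * z - 2 * t * \<sigma> - \<sigma> * \<tau> - 1) * \<phi> + t * \<sigma> + 1"
proof -
  have "D * ((t + \<tau>) * \<alpha>) = D * ((1 + t * \<sigma>) * \<beta> - \<theta> + t * \<eta>)"
  proof -
    have "D * ((t + \<tau>) * \<alpha>) = (t + \<tau>) * (D * \<alpha>)" by simp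
    also have "\<dots> = (1 + t * \<sigma>) * (D * \<beta>) - D * \<theta> + D * (t * \<eta>)"
      unfolding assms(2,3) by (simp add: assms(1) algebra_simps)
    finally show ?thesis by (simp add: algebra_simps)
  qed
  then have \<alpha>: "(t + \<tau>) * \<alpha> = (1 + t * \<sigma>) * \<beta> - \<theta> + t * \<eta>" using \<open>D \<noteq> 0\<close> by simp
  have "(t + \<tau>) * (1 + \<alpha> * \<beta>) = (t + \<tau>) + ((t + \<tau>) * \<alpha>) * \<beta>" by (simp add: algebra_simps)
  then have g: "(t + \<tau>) * (1 + \<alpha> * \<beta>) = (t + \<tau>) + ((1 + t * \<sigma>) * \<beta> - \<theta> + t * \<eta>) * \<beta>"
    unfolding \<alpha> .
  have \<beta>: "\<beta> = \<eta> * \<tau> + \<theta> + \<sigma> * \<tau> * \<beta>" using assms(3) unfolding assms(1) by (simp add: algebra_simps)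
  have "(1 + t * \<sigma>) * ((1 - \<beta> * z) * \<phi> - 1)\<^sup>2 - (D - A * z) * \<phi> * ((1 - \<beta> * z) * \<phi> - 1)
      + (t + \<tau>) * (1 + \<alpha> * \<beta>) * z\<^sup>2 * \<phi>\<^sup>2
    - ((z\<^sup>2 + \<eta> * z + \<sigma>) * (t + \<tau>) * \<phi>\<^sup>2
        + ((\<theta> - t * \<eta>) * z - 2 * t * \<sigma> - \<sigma> * \<tau> - 1) * \<phi> + t * \<sigma> + 1)
    = z * \<phi>\<^sup>2 * (\<beta> - (\<eta> * \<tau> + \<theta> + \<sigma> * \<tau> * \<beta>))"
    unfolding g assms(1,4) by (simp add: power2_eq_square algebra_simps)
  then show ?thesis using \<beta> by simp
qed

theorem theorem4p1:
  fixes \<eta> \<theta> \<sigma> \<tau> :: real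
  assumes "\<sigma> \<ge> 0" and "\<tau> \<ge> 0" and "\<sigma> * \<tau> < 1"
    and "1 + ((\<eta> + \<theta> * \<sigma>) / (1 - \<sigma> * \<tau>)) * ((\<eta> * \<tau> + \<theta>) / (1 - \<sigma> * \<tau>)) > 0"
  shows "\<forall>t > 0. \<forall>(\<phi> :: real \<Rightarrow> real) \<delta>.
     \<delta> > 0 \<and> continuous_on (ball 0 \<delta>) \<phi> \<and> \<phi> 0 = 1 \<and>
     (\<forall>z \<in> ball 0 \<delta>.
        (z\<^sup>2 + \<eta> * z + \<sigma>) * (t + \<tau>) * (\<phi> z)\<^sup>2
        + ((\<theta> - t * \<eta>) * z - 2 * t * \<sigma> - \<sigma> * \<tau> - 1) * \<phi> z + t * \<sigma> + 1 = 0)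
     \<longrightarrow>
     (\<exists>\<nu>. is_mgf_of \<phi> \<nu> \<and> (\<forall>\<nu>'. is_mgf_of \<phi> \<nu>' \<longrightarrow> \<nu>' = \<nu>) \<and>
        (\<forall>P. quadratic_harness P \<eta> \<theta> \<sigma> \<tau> (- \<sigma> * \<tau>) \<longrightarrow>
           (\<forall>p. \<exists>q. generator_is P t p q \<and>
              (\<forall>x. poly q x = (1 + \<eta> * x + \<sigma> * x\<^sup>2) / (1 + \<sigma> * t) *
                     (\<integral>y. deriv (\<lambda>x'. divdiff p x' y) x \<partial>\<nu>)))))"
proof (intro allI impI)
  fix t :: real and \<phi> :: "real \<Rightarrow> real" and \<delta>
  assume t: "t > 0" and "\<delta> > 0 \<and> continuous_on (ball 0 \<delta>) \<phi> \<and> \<phi> 0 = 1 \<and>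
     (\<forall>z \<in> ball 0 \<delta>.
        (z\<^sup>2 + \<eta> * z + \<sigma>) * (t + \<tau>) * (\<phi> z)\<^sup>2
        + ((\<theta> - t * \<eta>) * z - 2 * t * \<sigma> - \<sigma> * \<tau> - 1) * \<phi> z + t * \<sigma> + 1 = 0)"
  then have \<delta>: "\<delta> > 0" and cont: "continuous_on (ball 0 \<delta>) \<phi>" and "\<phi> 0 = 1"
    and quad: "\<And>z. \<bar>z\<bar> < \<delta> \<Longrightarrow> (z\<^sup>2 + \<eta> * z + \<sigma>) * (t + \<tau>) * (\<phi> z)\<^sup>2
        + ((\<theta> - t * \<eta>) * z - 2 * t * \<sigma> - \<sigma> * \<tau> - 1) * \<phi> z + t * \<sigma> + 1 = 0"
    by auto
  define D where "D = 1 - \<sigma> * \<tau>"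
  define \<alpha> where "\<alpha> = (\<eta> + \<theta> * \<sigma>) / (1 - \<sigma> * \<tau>)"
  define \<beta> where "\<beta> = (\<eta> * \<tau> + \<theta>) / (1 - \<sigma> * \<tau>)"
  define A where "A = 2 * (1 + t * \<sigma>) * \<beta> - \<theta> + t * \<eta>"
  define g where "g = (t + \<tau>) * (1 + \<alpha> * \<beta>) / D"
  have D: "D > 0" using assms by (simp add: D_def)
  have D\<alpha>\<beta>: "D * \<alpha> = \<eta> + \<theta> * \<sigma>" "D * \<beta> = \<eta> * \<tau> + \<theta>"
    using D by (simp_all add: D_def \<alpha>_def \<beta>_def)
  have Dg: "D * g = (t + \<tau>) * (1 + \<alpha> * \<beta>)" using D by (simp add: g_def)
  have "1 + t * \<sigma> > 0" using assms t by (simp add: add_pos_nonneg)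
  have g: "g > 0" using D t assms unfolding g_def \<alpha>_def \<beta>_def by simp
  have "\<exists>\<nu>. is_mgf_of \<phi> \<nu>"
  proof (rule jacobi_mgf[where g = g and b = "g * (1 + t * \<sigma>) / D" and d = \<beta> and a = "A / D" and \<delta> = \<delta>])
    show "isCont \<phi> 0"
      using cont \<delta> by (simp add: continuous_on_eq_continuous_at)
    fix z :: real assume z: "\<bar>z\<bar> < \<delta>"
    let ?y = "(1 - \<beta> * z) * \<phi> z - 1"
    have "g * (1 + t * \<sigma>) / D * ?y\<^sup>2 - g * (1 - A / D * z) * \<phi> z * ?y + g\<^sup>2 * z\<^sup>2 * (\<phi> z)\<^sup>2
       = g / D * ((1 + t * \<sigma>) * ?y\<^sup>2 - (D - A * z) * \<phi> z * ?y + D * g * z\<^sup>2 * (\<phi> z)\<^sup>2)"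
    proof -
      have e: "g * (1 + t * \<sigma>) / D = g / D * (1 + t * \<sigma>)" "g * (1 - A / D * z) = g / D * (D - A * z)"
        "g\<^sup>2 = g / D * (D * g)"
        using D by (simp_all add: field_simps power2_eq_square)
      have "k * u * v\<^sup>2 - k * d * f * v + k * h * x * f\<^sup>2 = k * (u * v\<^sup>2 - d * f * v + h * x * f\<^sup>2)"
        for k u v d f h x :: real by (simp add: algebra_simps)
      from this[of "g / D" "1 + t * \<sigma>" ?y "D - A * z" "\<phi> z" "D * g" "z\<^sup>2"]
      show ?thesis by (simp only: e)
    qed
    also have "\<dots> = 0"
      unfolding Dg generating_function_algebra[OF D_def D\<alpha>\<beta> A_def D[THEN less_imp_neq, symmetric]] quad[OF z]
      by simp
    finally show "g * (1 + t * \<sigma>) / D * ?y\<^sup>2 - g * (1 - A / D * z) * \<phi> z * ?y + g\<^sup>2 * z\<^sup>2 * (\<phi> z)\<^sup>2 = 0" .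
  qed (use g D \<open>1 + t * \<sigma> > 0\<close> \<open>\<phi> 0 = 1\<close> \<delta> in auto)
  then obtain \<nu> where \<nu>: "is_mgf_of \<phi> \<nu>" by blast
  define m where "m = (\<lambda>k. \<integral>y. y ^ k \<partial>\<nu>)"
  have int: "integrable \<nu> (\<lambda>y. y ^ k)" for k using \<nu> by (simp add: is_mgf_of_def)
  interpret \<nu>: prob_space \<nu> using \<nu> by (simp add: is_mgf_of_def)
  have m_0: "m 0 = 1" by (simp add: m_def \<nu>.prob_space)
  define C where "C = smult (1 / (1 + \<sigma> * t)) [:1, \<eta>, \<sigma>:]"
  have nz: "1 + \<sigma> * t \<noteq> 0" using \<open>1 + t * \<sigma> > 0\<close> by (simp add: mult.commute)
  have eqs: "commutator_eqs \<eta> \<theta> \<sigma> \<tau> t (\<lambda>n. C * dquot m n)"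
    unfolding C_def m_def
    by (intro commutator_eqs_dquot mgf_fps_equation[OF \<nu> \<delta> quad] m_0[unfolded m_def] nz)
  have "\<exists>q. generator_is P t p q \<and> (\<forall>x. poly q x = (1 + \<eta> * x + \<sigma> * x\<^sup>2) / (1 + \<sigma> * t) *
                     (\<integral>y. deriv (\<lambda>x'. divdiff p x' y) x \<partial>\<nu>))"
    if qh: "quadratic_harness P \<eta> \<theta> \<sigma> \<tau> (- \<sigma> * \<tau>)" for P p
  proof -
    obtain X where "harness P X \<eta> \<theta> \<sigma> \<tau>"
      using qh unfolding quadratic_harness_def harness_def by blast
    then interpret harness P X \<eta> \<theta> \<sigma> \<tau> .
    have "H t = (\<lambda>n. C * dquot m n)"
      by (rule commutator_unique[OF commutator_eqs_H eqs]) (use t assms in auto)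
    \<comment> \<open>The product rule gives \<open>pderiv (dquot m (Suc n)) = dquot m n + x *
      pderiv (dquot m n)\<close>, so the commutator of \<open>C * pderiv (dquot m n)\<close> with
      multiplication by \<open>x\<close> is \<open>C * dquot m n\<close>, which is
      \<open>H t n\<close>.\<close>
    then have "generator_is P t p (qapp (\<lambda>n. C * pderiv (dquot m n)) p)"
      by (intro generator_limit) (use t assms in \<open>auto simp: pderiv_pCons distrib_left\<close>)
    moreover have "poly (qapp (\<lambda>n. C * pderiv (dquot m n)) p) x = (1 + \<eta> * x + \<sigma> * x\<^sup>2) / (1 + \<sigma> * t) *
                     (\<integral>y. deriv (\<lambda>x'. divdiff p x' y) x \<partial>\<nu>)" for x
    proof -
      have "poly C x = (1 + \<eta> * x + \<sigma> * x\<^sup>2) / (1 + \<sigma> * t)"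
      proof -
        have "poly [:1, \<eta>, \<sigma>:] x = 1 + \<eta> * x + \<sigma> * x\<^sup>2"
          by (simp add: power2_eq_square algebra_simps)
        then show ?thesis by (simp only: C_def poly_smult) simp
      qed
      moreover have "qapp (\<lambda>n. C * pderiv (dquot m n)) p = C * pderiv (qapp (dquot m) p)"
        by (simp add: qapp_def pderiv_sum pderiv_smult sum_distrib_left)
      ultimately show ?thesis
        unfolding integral_deriv_divdiff[OF int] m_def by simp
    qed
    ultimately show ?thesis by blast
  qed
  then show "\<exists>\<nu>. is_mgf_of \<phi> \<nu> \<and> (\<forall>\<nu>'. is_mgf_of \<phi> \<nu>' \<longrightarrow> \<nu>' = \<nu>) \<and>
        (\<forall>P. quadratic_harness P \<eta> \<theta> \<sigma> \<tau> (- \<sigma> * \<tau>) \<longrightarrow>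
           (\<forall>p. \<exists>q. generator_is P t p q \<and>
              (\<forall>x. poly q x = (1 + \<eta> * x + \<sigma> * x\<^sup>2) / (1 + \<sigma> * t) *
                     (\<integral>y. deriv (\<lambda>x'. divdiff p x' y) x \<partial>\<nu>))))"
    using \<nu> is_mgf_of_unique[OF \<nu>] by blast
qed

end
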